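(* Let $n\ge 2$, let $Q$ be the $n$-dimensional unit cube, and for $k\in\mathbb{N}$ let $\lambda_k^*$ be the minimum of $\lambda_k(R)$ and $\mu_k^*$ the maximum of $\mu_k(R)$ over all $n$-dimensional unit-measure cuboids $R$. Then, for any admissible exponent $\theta_n$ (as defined in the context), as $k\to\infty$, $$|\lambda_k(Q)-\lambda_k^*| = O\bigl(k^{(\theta_n-(n-2))/n}\bigr),\qquad |\mu_k(Q)-\mu_k^*| = O\bigl(k^{(\theta_n-(n-2))/n}\bigr).$$
   Context: $\mathbb{N}=\{1,2,\dots\}$. An $n$-dimensional unit-measure cuboid is a domain $R=\prod_{i=1}^n (0,a_i)\subset\mathbb{R}^n$ with $a_i>0$ and $\prod_{i=1}^n a_i=1$. $\lambda_1(R)\le\lambda_2(R)\le\dots$ are the eigenvalues of the Dirichlet Laplacian on $R$, repeated according to multiplicity: the numbers $\sum_{j=1}^n \pi^2 i_j^2/a_j^2$ with $i_j$ positive integers, in non-decreasing order. $0=\mu_0(R)\le\mu_1(R)\le\dots$ are the eigenvalues of the Neumann Laplacian on $R$, repeated according to multiplicity and indexed from $0$: the numbers $\sum_{j=1}^n \pi^2 i_j^2/a_j^2$ with $i_j$ non-negative integers, in non-decreasing order. The minimum defining $\lambda_k^*$ and the maximum defining $\mu_k^*$ are attained for every $k\in\mathbb{N}$. Admissible exponent: $\theta_n$ denotes any exponent such that for all $a_1,\dots,a_n>0$, $$\#\{z\in\mathbb{Z}^n: a_1^{-2}z_1^2+\dots+a_n^{-2}z_n^2\le t^2\}-\omega_n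 t^n\prod_{i=1}^n a_i = O(t^{\theta_n}),\quad t\to\infty,$$ uniformly for $a_1,\dots,a_n$ in compact subsets of $(0,\infty)$, where $\omega_n$ is the volume of the unit ball in $\mathbb{R}^n$. It is known that for every $n\ge2$ there are admissible exponents with $\theta_n<n-1$. *)

theory Defs
  imports "HOL-Analysis.Analysis" "HOL-Library.Landau_Symbols"
begin

text \<open>
  A cuboid \<open>(0, a\<^sub>1) \<times> \<dots> \<times> (0, a\<^sub>n)\<close> is represented by its side lengths, a function
  \<open>a :: nat \<Rightarrow> real\<close> of which only the values at the indices below \<open>n\<close> matter.
\<close>

definition unit_measure_cuboids :: "nat \<Rightarrow> (nat \<Rightarrow> real) set" where
  "unit_measure_cuboids n = {a. (\<forall>j<n. 0 < a j) \<and> (\<Prod>j<n. a j) = 1}"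

definition unit_cube :: "nat \<Rightarrow> real" where
  "unit_cube = (\<lambda>_. 1)"

text \<open>
  The values of the family \<open>f\<close> over \<open>I\<close>, repeated according to multiplicity and listed in
  non-decreasing order, starting at position \<open>0\<close>. Such a listing exists and is unique whenever
  \<open>I\<close> is infinite and all sets \<open>{i \<in> I. f i \<le> x}\<close> are finite, as is the case below for \<open>n \<ge> 1\<close>
  and positive side lengths.
\<close>

definition nondecreasing_listing :: "'i set \<Rightarrow> ('i \<Rightarrow> real) \<Rightarrow> nat \<Rightarrow> real" where
  "nondecreasing_listing I f =
     (THE e. incseq e \<and> (\<exists>b. bij_betw b UNIV I \<and> (\<forall>k. e k = f (b k))))"

text \<open>
  Separation of variables: the eigenfunctions on the cuboid with sides \<open>a\<close> are the products of
  \<open>sin (\<pi> i\<^sub>j x\<^sub>j / a\<^sub>j)\<close> with \<open>i\<^sub>j \<ge> 1\<close> (Dirichlet), respectively of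
  \<open>cos (\<pi> i\<^sub>j x\<^sub>j / a\<^sub>j)\<close> with \<open>i\<^sub>j \<ge> 0\<close> (Neumann).
\<close>

definition mode_eigenvalue :: "nat \<Rightarrow> (nat \<Rightarrow> real) \<Rightarrow> (nat \<Rightarrow> nat) \<Rightarrow> real" where
  "mode_eigenvalue n a i = (\<Sum>j<n. pi\<^sup>2 * (real (i j))\<^sup>2 / (a j)\<^sup>2)"

text \<open>Dirichlet eigenvalues are indexed from \<open>1\<close>, Neumann eigenvalues from \<open>0\<close>.\<close>

definition dirichlet_eigenvalue :: "nat \<Rightarrow> nat \<Rightarrow> (nat \<Rightarrow> real) \<Rightarrow> real" where
  "dirichlet_eigenvalue n k a =
     nondecreasing_listing ({..<n} \<rightarrow>\<^sub>E {1..}) (mode_eigenvalue n a) (k - 1)"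

definition neumann_eigenvalue :: "nat \<Rightarrow> nat \<Rightarrow> (nat \<Rightarrow> real) \<Rightarrow> real" where
  "neumann_eigenvalue n k a =
     nondecreasing_listing ({..<n} \<rightarrow>\<^sub>E UNIV) (mode_eigenvalue n a) k"

definition min_dirichlet_eigenvalue :: "nat \<Rightarrow> nat \<Rightarrow> real" where
  "min_dirichlet_eigenvalue n k =
     (LEAST l. l \<in> dirichlet_eigenvalue n k ` unit_measure_cuboids n)"

definition max_neumann_eigenvalue :: "nat \<Rightarrow> nat \<Rightarrow> real" where
  "max_neumann_eigenvalue n k =
     (GREATEST m. m \<in> neumann_eigenvalue n k ` unit_measure_cuboids n)"

definition ellipsoid_lattice_points :: "nat \<Rightarrow> (nat \<Rightarrow> real) \<Rightarrow> real \<Rightarrow> (nat \<Rightarrow> int) set" where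
  "ellipsoid_lattice_points n a t =
     {z \<in> {..<n} \<rightarrow>\<^sub>E UNIV. (\<Sum>j<n. (real_of_int (z j))\<^sup>2 / (a j)\<^sup>2) \<le> t\<^sup>2}"

text \<open>
  Uniformity on compact sets: both the implied constant and the threshold for \<open>t\<close> may depend
  on \<open>K\<close>, but not on the side lengths taken from \<open>K\<close>.
\<close>

definition admissible_exponent :: "nat \<Rightarrow> real \<Rightarrow> bool" where
  "admissible_exponent n \<theta> \<longleftrightarrow>
     (\<forall>K. compact K \<and> K \<subseteq> {0<..} \<longrightarrow>
       (\<exists>C. \<forall>\<^sub>F t in at_top. \<forall>a. (\<forall>j<n. a j \<in> K) \<longrightarrow>
         \<bar>real (card (ellipsoid_lattice_points n a t)) -
            unit_ball_vol (real n) * t ^ n * (\<Prod>j<n. a j)\<bar> \<le> C * t powr \<theta>))"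

end

(*
  Write lambda = (pi t)^2. The number of eigenvalues up to lambda is the number of lattice points
  of the ellipsoid with semi-axes t a_j in the open (Dirichlet) or closed (Neumann) positive
  orthant; inclusion-exclusion over the coordinate hyperplanes turns the assumed asymptotics
  for all integer points into

    N_a(t) = v_n t^n -+ (v_{n-1} / 2) t^(n-1) sum_j 1/a_j + O(t^theta),

  with v_m = omega_m / 2^m and the sign - for Dirichlet, + for Neumann. The terms of codimension
  at least 2 are O(t^(n-2)), hence O(t^theta): since the cube count is constant for t^2 in
  [m, m + 1), an admissible theta is at least n - 2.

  By AM-GM, sum_j 1/a_j >= n, with equality for the cube. So an optimal cuboid beats the cube's
  counting function by at most O(t^theta), which compared with its growth rate t^(n-1) is a shift
  of t by O(t^(theta-n+1)), that is of lambda by O(t^(theta-n+2)), and t is of order k^(1/n).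

  For uniformity the sides of the optimal cuboids must stay in a compact set. Slicing orthogonally
  to the j-th axis and comparing the sum over slices with an integral gives, with c > 0 depending
  only on n, a Dirichlet count of at most v_n t^n - c t^(n-1)/a_j and a Neumann count of at least
  v_n t^n + c t^(n-1)/a_j. Against the elementary bounds v_n t^n -+ C t^(n-1) for the cube this
  forces a_j >= c/C whenever a cuboid is at least as good as the cube. The same bound gives the
  compactness needed for the optima to be attained.
*)

theory Submission
  imports Defs
begin

text \<open>The hypothesis concerns integer points in dimension n only, and its constants depend on
  a compact range of sides. Nothing is therefore known about lattice errors of the faces: their
  counts enter only through volume bounds with error O(t^(n-2)), which is why theta >= n - 2 has to
  be derived. And before the hypothesis can be used at all, thin cuboids must be excluded by
  estimates whose constants do not depend on the sides.

  The uniform surface gain comes from half steps. On a unit cell the integral of a decreasing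
  function is compared with its values at an endpoint and at the midpoint; compared with the
  endpoint sum, half of the drop between these two points is gained. On about A/2 cells the i-th
  drop is at least of order i/A^2, a total bounded below independently of A.

  Asymptotics are never inverted. The eigenvalue pi^2 s^2 is used through the equivalence of s <= t
  with the count at t reaching k (Dirichlet) or exceeding k (Neumann). Strictly below s the count is
  at most k, and continuity carries polynomial bounds up to s, so multiplicities need no separate
  treatment.\<close>

section \<open>Slices of the unit ball and Riemann sums\<close>

text \<open>The \<open>m\<close>-th power of the radius of the slice of the unit ball at height \<open>x \<ge> 0\<close>.\<close>

definition ball_profile :: "nat \<Rightarrow> real \<Rightarrow> real" where
  "ball_profile m x = (if x \<le> 1 then sqrt (1 - x\<^sup>2) ^ m else 0)"

text \<open>The integral of \<open>sqrt (1 - x\<^sup>2) ^ m\<close> over [0, 1]: the factor that one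
  further direction contributes to an orthant volume per unit of its semi-axis. The 2 in the
  denominator keeps the half of the ball on one side of the slicing hyperplane.\<close>

definition ball_ratio :: "nat \<Rightarrow> real" where
  "ball_ratio m = unit_ball_vol (real (Suc m)) / (2 * unit_ball_vol (real m))"

lemma ball_profile_nonneg: "0 \<le> x \<Longrightarrow> 0 \<le> ball_profile m x"
  by (simp add: ball_profile_def power_le_one)

lemma ball_profile_0 [simp]: "ball_profile m 0 = 1"
  by (simp add: ball_profile_def)

lemma ball_profile_antimono: "0 \<le> x \<Longrightarrow> x \<le> y \<Longrightarrow> ball_profile m y \<le> ball_profile m x"
  by (auto simp: ball_profile_def power_le_one intro!: power_mono)

text \<open>The source of the surface terms: the profile drops quadratically on the first half of its range.\<close>

lemma ball_profile_drop:
  assumes "m \<ge> 1" "0 \<le> x" "x \<le> y" "y \<le> 1" "x \<le> 1 / 2"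
  shows "(3 / 4) ^ (m - 1) / 2 * (y\<^sup>2 - x\<^sup>2) \<le> ball_profile m x - ball_profile m y"
proof -
  obtain p where m: "m = Suc p" using assms(1) by (cases m) auto
  define u w where "u = 1 - x\<^sup>2" and "w = 1 - y\<^sup>2"
  have "y\<^sup>2 \<le> 1" "x\<^sup>2 \<le> y\<^sup>2" using assms by (auto simp: power_le_one intro: power_mono)
  moreover have "x\<^sup>2 \<le> (1/2)\<^sup>2" using assms by (intro power_mono) auto
  ultimately have w: "0 \<le> w" "w \<le> u" "3/4 \<le> u" "u \<le> 1"
    by (auto simp: u_def w_def power2_eq_square)
  \<comment> \<open>Squaring the profiles leaves polynomials in u and w, with u >= 3/4 because x <=
    1/2. The conjugate factor split off below is at most 2, whence the division by 2.\<close>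
  have "(3 / 4) ^ p * (u - w) \<le> u ^ p * (u - w)"
    using w by (intro mult_right_mono power_mono) auto
  also have "\<dots> \<le> u ^ m - w ^ m"
  proof -
    have "w ^ p * w \<le> u ^ p * w" using w by (intro mult_right_mono power_mono) auto
    thus ?thesis by (simp add: m algebra_simps)
  qed
  also have "\<dots> = (sqrt u ^ m - sqrt w ^ m) * (sqrt u ^ m + sqrt w ^ m)"
  proof -
    have "u ^ m = (sqrt u ^ m) * (sqrt u ^ m)" "w ^ m = (sqrt w ^ m) * (sqrt w ^ m)"
      using w by (simp_all flip: power_mult_distrib)
    thus ?thesis by (simp add: algebra_simps)
  qed
  also have "\<dots> \<le> (sqrt u ^ m - sqrt w ^ m) * 2"
  proof (intro mult_left_mono)
    have "sqrt u ^ m \<le> 1" "sqrt w ^ m \<le> 1" using w by (auto intro!: power_le_one)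
    thus "sqrt u ^ m + sqrt w ^ m \<le> 2" by simp
    show "0 \<le> sqrt u ^ m - sqrt w ^ m" using w by (auto intro: power_mono)
  qed
  finally have "(3 / 4) ^ p * (u - w) / 2 \<le> sqrt u ^ m - sqrt w ^ m" by simp
  moreover have "ball_profile m x = sqrt u ^ m" "ball_profile m y = sqrt w ^ m" "u - w = y\<^sup>2 - x\<^sup>2"
    using assms by (simp_all add: ball_profile_def u_def w_def)
  ultimately show ?thesis by (simp add: m)
qed

lemma unit_ball_vol_Suc:
  "unit_ball_vol (real (Suc m)) = unit_ball_vol (real m) * Beta (1/2) (real m / 2 + 1)"
  by (auto simp: unit_ball_vol_def Beta_def Gamma_eq_zero_iff field_simps
          Gamma_one_half_real powr_half_sqrt [symmetric] powr_add [symmetric])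

lemma ball_ratio_eq: "ball_ratio m = Beta (1/2) (real m / 2 + 1) / 2"
proof -
  have "unit_ball_vol (real m) \<noteq> 0" using unit_ball_vol_pos[of "real m"] by linarith
  thus ?thesis unfolding ball_ratio_def unit_ball_vol_Suc by simp
qed

lemma ball_ratio_pos: "ball_ratio m > 0"
  unfolding ball_ratio_def by (intro divide_pos_pos mult_pos_pos) auto

text \<open>Reflection extends the integral to [-1, 1], where it is the Beta value known from the
  computation of ball volumes.\<close>

lemma has_integral_ball_ratio: "((\<lambda>x. sqrt (1 - x\<^sup>2) ^ m) has_integral ball_ratio m) {0..1}"
proof -
  let ?f = "\<lambda>x::real. sqrt (1 - x\<^sup>2) ^ m"
  have int: "?f integrable_on {a..b}" for a b
    by (intro integrable_continuous_interval continuous_intros)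
  define J where "J = integral {0..1} ?f"
  have r: "(?f has_integral J) {0..1}"
    using int by (auto simp: J_def has_integral_integral)
  have "((\<lambda>x. ?f (- x)) has_integral J) {-1..-0}"
    by (subst has_integral_reflect_real) (use r in auto)
  hence l: "(?f has_integral J) {-1..0}" by simp
  have "(?f has_integral (J + J)) {-1..1}"
    by (rule has_integral_combine[OF _ _ l r]) auto
  moreover have nn: "0 \<le> ?f x" if "x \<in> {-1..1}" for x
    using that by (auto simp: abs_square_le_1 intro!: zero_le_power)
  ultimately have "integral\<^sup>N lborel (\<lambda>x. indicator {-1..1} x * ?f x) = ennreal (J + J)"
    by (intro nn_integral_has_integral_lebesgue) auto
  with emeasure_cball_aux_integral[of m]
  have "ennreal (J + J) = ennreal (Beta (1/2) (real m / 2 + 1))" by simp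
  moreover have "J \<ge> 0" unfolding J_def
    by (intro integral_nonneg int nn) auto
  moreover have "Beta (1/2) (real m / 2 + 1) \<ge> 0"
    using ball_ratio_pos[of m] by (simp add: ball_ratio_eq)
  ultimately have "J = ball_ratio m" by (simp add: ball_ratio_eq)
  thus ?thesis using r by simp
qed

lemma has_integral_ball_profile:
  assumes "0 < A" "A \<le> b"
  shows "((\<lambda>x. ball_profile m (x / A)) has_integral A * ball_ratio m) {0..b}"
proof -
  have "((\<lambda>x. sqrt (1 - (x / A)\<^sup>2) ^ m) has_integral A * ball_ratio m) {0..A}"
    using has_integral_affinity'[of "\<lambda>x::real. sqrt (1 - x\<^sup>2) ^ m" "ball_ratio m" 0 1 "1/A" 0]
      has_integral_ball_ratio[of m] assms
    by (simp add: mult.commute)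
  hence 1: "((\<lambda>x. ball_profile m (x / A)) has_integral A * ball_ratio m) {0..A}"
    by (rule has_integral_eq[rotated]) (use assms in \<open>auto simp: ball_profile_def\<close>)
  \<comment> \<open>At \<open>x = A\<close> the profile is \<open>0 ^ m\<close>, which is 1 for
    \<open>m = 0\<close>; hence the exceptional point.\<close>
  have 2: "((\<lambda>x. ball_profile m (x / A)) has_integral 0) {A..b}"
    by (rule has_integral_spike_finite[of "{A}" _ _ "\<lambda>_. 0"]) (use assms in \<open>auto simp: ball_profile_def\<close>)
  show ?thesis using has_integral_combine[OF _ _ 1 2] assms by simp
qed

section \<open>Riemann sums of decreasing functions and their defect\<close>

lemma antimono_integral_bounds:
  fixes f :: "real \<Rightarrow> real"
  assumes "a \<le> b" and anti: "\<And>x y. a \<le> x \<Longrightarrow> x \<le> y \<Longrightarrow> y \<le> b \<Longrightarrow> f y \<le> f x"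
  shows "f integrable_on {a..b}"
    and "(b - a) * f b \<le> integral {a..b} f" and "integral {a..b} f \<le> (b - a) * f a"
proof -
  have "(\<lambda>x. - f x) integrable_on {a..b}"
    by (rule integrable_on_mono_on) (auto simp: mono_on_def intro: anti)
  thus int: "f integrable_on {a..b}" using integrable_neg by fastforce
  have "integral {a..b} (\<lambda>_. f b) \<le> integral {a..b} f"
    by (rule integral_le) (use int anti in auto)
  thus "(b - a) * f b \<le> integral {a..b} f" using assms(1) by simp
  have "integral {a..b} f \<le> integral {a..b} (\<lambda>_. f a)"
    by (rule integral_le) (use int anti in auto)
  thus "integral {a..b} f \<le> (b - a) * f a" using assms(1) by simp
qed

text \<open>Midpoints are kept because the difference to the endpoints is what quantifies the surface terms.\<close>

lemma antimono_integral_half_steps: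
  fixes f :: "real \<Rightarrow> real"
  assumes anti: "\<And>x y. 0 \<le> x \<Longrightarrow> x \<le> y \<Longrightarrow> f y \<le> f x"
  shows "(\<Sum>i<N. (f (real i + 1/2) + f (real i + 1)) / 2) \<le> integral {0..real N} f" (is "?P N")
    and "integral {0..real N} f \<le> (\<Sum>i<N. (f (real i) + f (real i + 1/2)) / 2)" (is "?Q N")
proof -
  have int: "f integrable_on {0..b}" if "0 \<le> b" for b
    by (rule antimono_integral_bounds) (use that anti in auto)
  have step: "integral {0..real (Suc N)} f = integral {0..real N} f +
     (integral {real N..real N + 1/2} f + integral {real N + 1/2..real N + 1} f)" for N
  proof -
    have "integral {0..real (Suc N)} f = integral {0..real N + 1/2} f + integral {real N + 1/2..real (Suc N)} f"
      by (rule Henstock_Kurzweil_Integration.integral_combine[symmetric]) (auto intro!: int)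
    also have "integral {0..real N + 1/2} f = integral {0..real N} f + integral {real N..real N + 1/2} f"
      by (rule Henstock_Kurzweil_Integration.integral_combine[symmetric]) (auto intro!: int)
    finally show ?thesis by (simp add: add.commute)
  qed
  have "?P N \<and> ?Q N"
  proof (induction N)
    case 0
    thus ?case by simp
  next
    case (Suc N)
    have "f (real N + 1/2) / 2 \<le> integral {real N..real N + 1/2} f"
         "integral {real N..real N + 1/2} f \<le> f (real N) / 2"
      using antimono_integral_bounds(2,3)[of "real N" "real N + 1/2" f] anti by auto
    moreover have "f (real N + 1) / 2 \<le> integral {real N + 1/2..real N + 1} f"
         "integral {real N + 1/2..real N + 1} f \<le> f (real N + 1/2) / 2"
      using antimono_integral_bounds(2,3)[of "real N + 1/2" "real N + 1" f] anti by auto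
    ultimately show ?case using Suc unfolding step by (simp add: add_divide_distrib)
  qed
  thus "?P N" "?Q N" by auto
qed

text \<open>The half-step bounds split into an endpoint sum and a surplus, half the drop between
  midpoint and endpoint in each cell. Any \<open>N\<close> with \<open>A <= real N\<close> serves,
  since the profile vanishes beyond \<open>A\<close>.\<close>

lemma ball_profile_half_steps:
  fixes m :: nat
  assumes "0 < A" "A \<le> real N"
  defines "f \<equiv> \<lambda>x. ball_profile m (x / A)"
  shows "(\<Sum>i<N. f (real i + 1)) + (\<Sum>i<N. f (real i + 1/2) - f (real i + 1)) / 2 \<le> A * ball_ratio m"
    and "A * ball_ratio m + (\<Sum>i<N. f (real i) - f (real i + 1/2)) / 2 \<le> (\<Sum>i<N. f (real i))"
proof -
  have anti: "f y \<le> f x" if "0 \<le> x" "x \<le> y" for x y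
    unfolding f_def using that assms by (intro ball_profile_antimono) (auto simp: divide_right_mono)
  have I: "integral {0..real N} f = A * ball_ratio m"
    unfolding f_def using has_integral_ball_profile[OF assms(1,2)] by (rule integral_unique)
  show "(\<Sum>i<N. f (real i + 1)) + (\<Sum>i<N. f (real i + 1/2) - f (real i + 1)) / 2 \<le> A * ball_ratio m"
    using antimono_integral_half_steps(1)[where f=f and N=N] anti I
    by (simp add: sum_divide_distrib[symmetric] sum.distrib sum_subtractf field_simps)
  show "A * ball_ratio m + (\<Sum>i<N. f (real i) - f (real i + 1/2)) / 2 \<le> (\<Sum>i<N. f (real i))"
    using antimono_integral_half_steps(2)[where f=f and N=N] anti I
    by (simp add: sum_divide_distrib[symmetric] sum.distrib sum_subtractf field_simps)
qed

text \<open>Dropping the surplus gives the first two bounds. For the third, the sums over left and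
  right endpoints differ by a telescoping amount, at most the value 1 at the origin.\<close>

lemma ball_profile_sum_bounds:
  assumes "0 < A" "A \<le> real N"
  shows "(\<Sum>i<N. ball_profile m ((real i + 1) / A)) \<le> A * ball_ratio m"
    and "A * ball_ratio m \<le> (\<Sum>i<N. ball_profile m (real i / A))"
    and "A * ball_ratio m - 1 \<le> (\<Sum>i<N. ball_profile m ((real i + 1) / A))"
proof -
  have anti: "ball_profile m (y / A) \<le> ball_profile m (x / A)" if "0 \<le> x" "x \<le> y" for x y
    using that assms by (intro ball_profile_antimono) (auto simp: divide_right_mono)
  have "(\<Sum>i<N. ball_profile m ((real i + 1/2) / A) - ball_profile m ((real i + 1) / A)) \<ge> 0"
       "(\<Sum>i<N. ball_profile m (real i / A) - ball_profile m ((real i + 1/2) / A)) \<ge> 0"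
    by (auto intro!: sum_nonneg anti)
  thus 1: "(\<Sum>i<N. ball_profile m ((real i + 1) / A)) \<le> A * ball_ratio m"
    and 2: "A * ball_ratio m \<le> (\<Sum>i<N. ball_profile m (real i / A))"
    using ball_profile_half_steps[OF assms, of m] by linarith+
  have "(\<Sum>i<N. ball_profile m (real (Suc i) / A) - ball_profile m (real i / A)) = 
      ball_profile m (real N / A) - ball_profile m (real 0 / A)"
    by (rule sum_lessThan_telescope)
  hence "(\<Sum>i<N. ball_profile m ((real i + 1) / A)) - (\<Sum>i<N. ball_profile m (real i / A)) = 
      ball_profile m (real N / A) - 1"
    by (simp add: sum_subtractf add.commute)
  moreover have "ball_profile m (real N / A) \<ge> 0" using assms by (intro ball_profile_nonneg) auto
  ultimately show "A * ball_ratio m - 1 \<le> (\<Sum>i<N. ball_profile m ((real i + 1) / A))" using 2 by linarith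
qed

text \<open>With \<kappa> = (3/4)^(m-1) / 2 the constant of the quadratic drop, this is \<kappa> /
  48: the drops add up to at least \<kappa> / 24, and half of them is gained. The factor 1/24 =
  (3/8)(1/9) comes from right endpoints; left endpoints would allow more.\<close>

definition sum_defect :: "nat \<Rightarrow> real" where
  "sum_defect m = (3 / 4) ^ (m - 1) / 96"

lemma sum_defect_pos: "sum_defect m > 0"
  by (simp add: sum_defect_def)

lemma sum_defect_le: "sum_defect m \<le> 1 / 96"
  by (simp add: sum_defect_def power_le_one)

lemma sum_of_nat_lessThan: "(\<Sum>i<M. real i) = real M * (real M - 1) / 2"
  by (induction M) (auto simp: field_simps)

text \<open>A gain independent of \<open>A\<close> needs \<open>m >= 1\<close>: for
  \<open>m = 0\<close> the sum counts the integers in [1, A] and is exact at integers. It also needs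
  a lower bound on \<open>A\<close>, as the right-hand side tends to 0 with
  \<open>A\<close>.\<close>

lemma ball_profile_sum_upper_defect:
  assumes "m \<ge> 1" "1 \<le> A" "A \<le> real N"
  shows "(\<Sum>i<N. ball_profile m ((real i + 1) / A)) + sum_defect m \<le> A * ball_ratio m"
proof -
  let ?f = "\<lambda>x. ball_profile m (x / A)"
  define \<kappa> :: real where "\<kappa> = (3 / 4) ^ (m - 1) / 2"
  have \<kappa>: "\<kappa> > 0" by (simp add: \<kappa>_def)
  have anti: "?f y \<le> ?f x" if "0 \<le> x" "x \<le> y" for x y
    using that assms by (intro ball_profile_antimono) (auto simp: divide_right_mono)
  have floor_bounds: "real (nat \<lfloor>x\<rfloor>) \<le> x \<and> real (nat \<lfloor>x\<rfloor>) > x - 1" if "x \<ge> 0" for x :: real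
    using that by linarith
  \<comment> \<open>The cells with i + 1 <= (A + 1) / 2 are those whose midpoint is at most A / 2,
    the range in which the quadratic drop is available.\<close>
  define M where "M = nat \<lfloor>(A + 1) / 2\<rfloor>"
  have M: "real M \<le> (A + 1) / 2" "real M > (A + 1) / 2 - 1"
    using floor_bounds[of "(A + 1) / 2"] assms unfolding M_def by auto
  hence M1: "M \<ge> 1" using assms by (cases M) auto
  have MN: "M \<le> N" 
  proof -
    have "real M \<le> real N" using M(1) assms(2,3) by argo
    thus ?thesis by simp
  qed
  have MA: "real M \<ge> A / 3" using M M1 by (cases "A \<le> 3") auto
  have "\<kappa> * (3/8) * (real M)\<^sup>2 / A\<^sup>2 \<le> \<kappa> / A\<^sup>2 * (\<Sum>i<M. real i + 3/4)"
  proof -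
    have "(\<Sum>i<M. real i + 3/4) \<ge> 3/8 * (real M)\<^sup>2"
    proof -
      have "(\<Sum>i<M. real i + 3/4) = real M * (real M - 1) / 2 + real M * (3/4)"
        by (simp only: sum.distrib sum_of_nat_lessThan) simp
      also have "\<dots> \<ge> 3/8 * (real M)\<^sup>2" using M1 by (simp add: field_simps power2_eq_square)
      finally show ?thesis .
    qed
    hence "\<kappa> / A\<^sup>2 * (3/8 * (real M)\<^sup>2) \<le> \<kappa> / A\<^sup>2 * (\<Sum>i<M. real i + 3/4)"
      using \<kappa> by (intro mult_left_mono) auto
    thus ?thesis by simp
  qed
  also have "\<dots> = (\<Sum>i<M. \<kappa> * (((real i + 1) / A)\<^sup>2 - ((real i + 1/2) / A)\<^sup>2))"
    unfolding sum_distrib_left using assms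
    by (intro sum.cong refl) (simp add: power2_eq_square field_simps)
  also have "\<dots> \<le> (\<Sum>i<M. ?f (real i + 1/2) - ?f (real i + 1))"
  proof (intro sum_mono)
    fix i assume "i \<in> {..<M}"
    hence "real i + 1 \<le> real M" by simp
    hence "real i + 1 \<le> (A + 1) / 2" using M by linarith
    thus "\<kappa> * (((real i + 1) / A)\<^sup>2 - ((real i + 1/2) / A)\<^sup>2) \<le> ?f (real i + 1/2) - ?f (real i + 1)"
      unfolding \<kappa>_def using assms by (intro ball_profile_drop) (auto simp: field_simps)
  qed
  also have "\<dots> \<le> (\<Sum>i<N. ?f (real i + 1/2) - ?f (real i + 1))"
    using MN by (intro sum_mono2) (auto intro!: anti)
  finally have "\<kappa> * (3/8) * (real M)\<^sup>2 / A\<^sup>2 \<le> (\<Sum>i<N. ?f (real i + 1/2) - ?f (real i + 1))" .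
  moreover have "\<kappa> / 24 \<le> \<kappa> * (3/8) * (real M)\<^sup>2 / A\<^sup>2"
  proof -
    have "(A/3)\<^sup>2 \<le> (real M)\<^sup>2" using MA assms by (intro power_mono) auto
    hence "1/9 \<le> (real M)\<^sup>2 / A\<^sup>2" using assms by (simp add: field_simps)
    hence "\<kappa> * (3/8) * (1/9) \<le> \<kappa> * (3/8) * ((real M)\<^sup>2 / A\<^sup>2)" using \<kappa> by (intro mult_left_mono) auto
    thus ?thesis by simp
  qed
  ultimately have "\<kappa> / 48 \<le> (\<Sum>i<N. ?f (real i + 1/2) - ?f (real i + 1)) / 2" by simp
  moreover have "sum_defect m = \<kappa> / 48" by (simp add: sum_defect_def \<kappa>_def)
  ultimately show ?thesis using ball_profile_half_steps(1)[of A N m] assms by linarith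
qed

text \<open>The height 0 is always among the summands, so the gain persists for arbitrarily small
  \<open>A\<close>: then the whole drop from 1 to 0 falls into the first half cell.\<close>

lemma ball_profile_sum_lower_defect:
  assumes "m \<ge> 1" "0 < A" "A \<le> real N"
  shows "A * ball_ratio m + sum_defect m \<le> (\<Sum>i<N. ball_profile m (real i / A))"
proof -
  let ?f = "\<lambda>x. ball_profile m (x / A)"
  have anti: "?f y \<le> ?f x" if "0 \<le> x" "x \<le> y" for x y
    using that assms by (intro ball_profile_antimono) (auto simp: divide_right_mono)
  show ?thesis
  proof (cases "A < 1/2")
    case True
    have N: "N \<ge> 1" using assms by (cases N) auto
    have "(\<Sum>i\<in>{0}. ?f (real i) - ?f (real i + 1/2)) \<le> (\<Sum>i<N. ?f (real i) - ?f (real i + 1/2))"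
      using N by (intro sum_mono2) (auto intro!: anti)
    moreover have "?f (1/2) = 0" using True assms by (simp add: ball_profile_def field_simps)
    ultimately have "1 / 2 \<le> (\<Sum>i<N. ?f (real i) - ?f (real i + 1/2)) / 2" by simp
    thus ?thesis using ball_profile_half_steps(2)[of A N m] assms sum_defect_le[of m] by linarith
  next
    case False
    define \<kappa> :: real where "\<kappa> = (3 / 4) ^ (m - 1) / 2"
    have \<kappa>: "\<kappa> > 0" by (simp add: \<kappa>_def)
    \<comment> \<open>Left endpoints i <= A / 2. The quadratic drop also needs i + 1/2 <= A, which
      for i = 0 is the case assumption A >= 1/2.\<close>
    define M where "M = Suc (nat \<lfloor>A / 2\<rfloor>)"
    have M: "real M \<le> A / 2 + 1" "real M > A / 2"
      unfolding M_def using assms by simp_all linarith+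
    have M_ge: "M \<ge> 1" by (simp add: M_def)
    have "\<kappa> * (1/4) * (real M)\<^sup>2 / A\<^sup>2 \<le> \<kappa> / A\<^sup>2 * (\<Sum>i<M. real i + 1/4)"
    proof -
      have "(\<Sum>i<M. real i + 1/4) \<ge> 1/4 * (real M)\<^sup>2"
      proof -
        have "(\<Sum>i<M. real i + 1/4) = real M * (real M - 1) / 2 + real M * (1/4)"
          by (simp only: sum.distrib sum_of_nat_lessThan) simp
        also have "\<dots> \<ge> 1/4 * (real M)\<^sup>2" using M_ge by (simp add: field_simps power2_eq_square)
        finally show ?thesis .
      qed
      hence "\<kappa> / A\<^sup>2 * (1/4 * (real M)\<^sup>2) \<le> \<kappa> / A\<^sup>2 * (\<Sum>i<M. real i + 1/4)"
        using \<kappa> by (intro mult_left_mono) auto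
      thus ?thesis by simp
    qed
    also have "\<dots> = (\<Sum>i<M. \<kappa> * (((real i + 1/2) / A)\<^sup>2 - (real i / A)\<^sup>2))"
      unfolding sum_distrib_left using assms
      by (intro sum.cong refl) (simp add: power2_eq_square field_simps)
    also have "\<dots> \<le> (\<Sum>i<M. ?f (real i) - ?f (real i + 1/2))"
    proof (intro sum_mono)
      fix i assume "i \<in> {..<M}"
      hence "real i + 1 \<le> real M" by simp
      hence "real i \<le> A / 2" using M by linarith
      moreover from this have "real i + 1/2 \<le> A" using False by (cases i) auto
      ultimately show "\<kappa> * (((real i + 1/2) / A)\<^sup>2 - (real i / A)\<^sup>2) \<le> ?f (real i) - ?f (real i + 1/2)"
        unfolding \<kappa>_def using assms by (intro ball_profile_drop) (auto simp: field_simps)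
    qed
    also have "\<dots> \<le> (\<Sum>i<N. ?f (real i) - ?f (real i + 1/2))"
    proof (intro sum_mono2)
      have "N \<ge> 1" using assms by (cases N) auto
      moreover have "M = 1" if "A < 2" using that assms by (simp add: M_def)
      moreover have "real M \<le> real N" if "A \<ge> 2" using that M assms by linarith
      ultimately have "M \<le> N" by (cases "A < 2") auto
      thus "{..<M} \<subseteq> {..<N}" by auto
    qed (auto intro!: anti)
    finally have "\<kappa> * (1/4) * (real M)\<^sup>2 / A\<^sup>2 \<le> (\<Sum>i<N. ?f (real i) - ?f (real i + 1/2))" .
    moreover have "\<kappa> / 24 \<le> \<kappa> * (1/4) * (real M)\<^sup>2 / A\<^sup>2"
    proof -
      have "(A/2)\<^sup>2 \<le> (real M)\<^sup>2" using M assms by (intro power_mono) auto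
      hence "1/4 \<le> (real M)\<^sup>2 / A\<^sup>2" using assms by (simp add: field_simps)
      hence "\<kappa> * (1/4) * (1/4) \<le> \<kappa> * (1/4) * ((real M)\<^sup>2 / A\<^sup>2)" using \<kappa> by (intro mult_left_mono) auto
      thus ?thesis using \<kappa> by simp
    qed
    ultimately have "\<kappa> / 48 \<le> (\<Sum>i<N. ?f (real i) - ?f (real i + 1/2)) / 2" by simp
    moreover have "sum_defect m = \<kappa> / 48" by (simp add: sum_defect_def \<kappa>_def)
    ultimately show ?thesis using ball_profile_half_steps(2)[of A N m] assms by linarith
  qed
qed

section \<open>Counting lattice points by slices\<close>

text \<open>
  The map \<open>r\<close> embeds the coordinates into the reals, so that the same recursion on dimension
  serves natural and integer points.
\<close>

definition coord_points :: "('b \<Rightarrow> real) \<Rightarrow> 'b set \<Rightarrow> nat set \<Rightarrow> (nat \<Rightarrow> real) \<Rightarrow> real \<Rightarrow> (nat \<Rightarrow> 'b) set" where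
  "coord_points r X S a t = {i \<in> S \<rightarrow>\<^sub>E X. (\<Sum>j\<in>S. (r (i j))\<^sup>2 / (a j)\<^sup>2) \<le> t\<^sup>2}"

lemma finite_coord_points:
  assumes S: "finite S" "\<And>j. j \<in> S \<Longrightarrow> 0 < a j" and fin: "\<And>x. finite {q \<in> X. \<bar>r q\<bar> \<le> x}"
  shows "finite (coord_points r X S a t)"
proof (rule finite_subset)
  show "coord_points r X S a t \<subseteq> (\<Pi>\<^sub>E j\<in>S. {q \<in> X. \<bar>r q\<bar> \<le> a j * \<bar>t\<bar>})"
  proof
    fix i assume i: "i \<in> coord_points r X S a t"
    have "\<bar>r (i j)\<bar> \<le> a j * \<bar>t\<bar>" if j: "j \<in> S" for j
    proof -
      have "(r (i j))\<^sup>2 / (a j)\<^sup>2 \<le> (\<Sum>j\<in>S. (r (i j))\<^sup>2 / (a j)\<^sup>2)"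
        by (rule member_le_sum) (use j S in auto)
      also have "\<dots> \<le> t\<^sup>2" using i by (simp add: coord_points_def)
      finally have "(r (i j) / a j)\<^sup>2 \<le> t\<^sup>2" by (simp add: power_divide)
      hence "\<bar>r (i j) / a j\<bar> \<le> \<bar>t\<bar>" by (simp only: abs_le_square_iff)
      thus ?thesis using S(2)[OF j] by (simp add: field_simps)
    qed
    thus "i \<in> (\<Pi>\<^sub>E j\<in>S. {q \<in> X. \<bar>r q\<bar> \<le> a j * \<bar>t\<bar>})"
      using i by (auto simp: coord_points_def PiE_iff)
  qed
qed (intro finite_PiE S fin)

text \<open>Fibration over the value q of coordinate j: the others fill an ellipsoid with the same
  sides and a smaller radius. Extensionality of the points makes (q, g) recoverable from
  \<open>g(j := q)\<close>.\<close>

lemma card_coord_points_insert: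
  assumes S: "finite S" "j \<notin> S" "\<And>i. i \<in> insert j S \<Longrightarrow> 0 < a i"
    and fin: "\<And>x. finite {q \<in> X. \<bar>r q\<bar> \<le> x}" and t: "0 \<le> t"
  shows "card (coord_points r X (insert j S) a t) =
    (\<Sum>q | q \<in> X \<and> \<bar>r q\<bar> \<le> a j * t. card (coord_points r X S a (sqrt (t\<^sup>2 - (r q)\<^sup>2 / (a j)\<^sup>2))))"
proof -
  let ?Q = "{q \<in> X. \<bar>r q\<bar> \<le> a j * t}" and ?h = "\<lambda>(q, g). g(j := q)"
  let ?B = "\<lambda>q. coord_points r X S a (sqrt (t\<^sup>2 - (r q)\<^sup>2 / (a j)\<^sup>2))"
  have aj: "0 < a j" using S by simp
  have rad: "(r q)\<^sup>2 / (a j)\<^sup>2 \<le> t\<^sup>2 \<longleftrightarrow> \<bar>r q\<bar> \<le> a j * t" for q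
  proof -
    have "(r q)\<^sup>2 / (a j)\<^sup>2 \<le> t\<^sup>2 \<longleftrightarrow> (r q)\<^sup>2 \<le> (a j * t)\<^sup>2"
      using aj by (simp add: field_simps)
    also have "\<dots> \<longleftrightarrow> \<bar>r q\<bar> \<le> \<bar>a j * t\<bar>" by (rule abs_le_square_iff[symmetric])
    finally show ?thesis using aj t by simp
  qed
  have sm: "(\<Sum>k\<in>insert j S. (r ((g(j := q)) k))\<^sup>2 / (a k)\<^sup>2) = (r q)\<^sup>2 / (a j)\<^sup>2 + (\<Sum>k\<in>S. (r (g k))\<^sup>2 / (a k)\<^sup>2)" for q g
  proof -
    have "(\<Sum>k\<in>S. (r ((g(j := q)) k))\<^sup>2 / (a k)\<^sup>2) = (\<Sum>k\<in>S. (r (g k))\<^sup>2 / (a k)\<^sup>2)"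
      using S(2) by (intro sum.cong) auto
    thus ?thesis using S by simp
  qed
  have nn: "0 \<le> (\<Sum>k\<in>S. (r (g k))\<^sup>2 / (a k)\<^sup>2)" for g by (intro sum_nonneg) auto
  have mem: "g(j := q) \<in> coord_points r X (insert j S) a t \<longleftrightarrow> (q, g) \<in> Sigma ?Q ?B"
    if "q \<in> X" "g \<in> S \<rightarrow>\<^sub>E X" for q g
  proof -
    have "g(j := q) \<in> insert j S \<rightarrow>\<^sub>E X" using that by (auto simp: PiE_insert_eq)
    hence "g(j := q) \<in> coord_points r X (insert j S) a t \<longleftrightarrow> (r q)\<^sup>2 / (a j)\<^sup>2 + (\<Sum>k\<in>S. (r (g k))\<^sup>2 / (a k)\<^sup>2) \<le> t\<^sup>2"
      unfolding coord_points_def mem_Collect_eq sm by simp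
    also have "\<dots> \<longleftrightarrow> (r q)\<^sup>2 / (a j)\<^sup>2 \<le> t\<^sup>2 \<and> (\<Sum>k\<in>S. (r (g k))\<^sup>2 / (a k)\<^sup>2) \<le> (sqrt (t\<^sup>2 - (r q)\<^sup>2 / (a j)\<^sup>2))\<^sup>2"
      using nn[of g] by (cases "(r q)\<^sup>2 / (a j)\<^sup>2 \<le> t\<^sup>2") auto
    finally show ?thesis using that rad[of q] by (simp add: coord_points_def)
  qed
  have "coord_points r X (insert j S) a t = ?h ` Sigma ?Q ?B"
  proof (intro equalityI subsetI)
    fix i assume i: "i \<in> coord_points r X (insert j S) a t"
    hence "i \<in> insert j S \<rightarrow>\<^sub>E X" by (simp add: coord_points_def)
    then obtain q g where qg: "q \<in> X" "g \<in> S \<rightarrow>\<^sub>E X" "i = g(j := q)" by (auto simp: PiE_insert_eq)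
    hence "(q, g) \<in> Sigma ?Q ?B" using mem i by simp
    thus "i \<in> ?h ` Sigma ?Q ?B" using qg(3) by force
  next
    fix i assume "i \<in> ?h ` Sigma ?Q ?B"
    then obtain q g where "(q, g) \<in> Sigma ?Q ?B" "i = g(j := q)" by auto
    moreover from this have "q \<in> X" "g \<in> S \<rightarrow>\<^sub>E X" by (auto simp: coord_points_def)
    ultimately show "i \<in> coord_points r X (insert j S) a t" using mem by simp
  qed
  moreover have "inj_on ?h (Sigma ?Q ?B)"
    by (rule inj_on_subset[OF inj_combinator[OF S(2), of "\<lambda>_. X"]]) (auto simp: coord_points_def)
  ultimately have "card (coord_points r X (insert j S) a t) = card (Sigma ?Q ?B)"
    by (simp add: card_image)
  also have "\<dots> = (\<Sum>q\<in>?Q. card (?B q))"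
    by (rule card_SigmaI) (use fin in simp, intro ballI finite_coord_points fin S, auto intro: S)
  finally show ?thesis by simp
qed

text \<open>The Dirichlet count; \<open>nonneg_count\<close> is the Neumann count and
  \<open>int_count\<close> that of the hypothesis. Indexing by a set of coordinates instead of a
  dimension makes coordinate faces instances without renumbering.\<close>

definition pos_count :: "nat set \<Rightarrow> (nat \<Rightarrow> real) \<Rightarrow> real \<Rightarrow> real" where
  "pos_count S a t = real (card (coord_points (real :: nat \<Rightarrow> real) {1..} S a t))"

definition nonneg_count :: "nat set \<Rightarrow> (nat \<Rightarrow> real) \<Rightarrow> real \<Rightarrow> real" where
  "nonneg_count S a t = real (card (coord_points (real :: nat \<Rightarrow> real) UNIV S a t))"

definition int_count :: "nat set \<Rightarrow> (nat \<Rightarrow> real) \<Rightarrow> real \<Rightarrow> real" where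
  "int_count S a t = real (card (coord_points real_of_int UNIV S a t))"

definition slice_radius :: "real \<Rightarrow> real \<Rightarrow> real \<Rightarrow> real" where
  "slice_radius b t x = sqrt (t\<^sup>2 - x\<^sup>2 / b\<^sup>2)"

lemma count_empty [simp]: "pos_count {} a t = 1" "nonneg_count {} a t = 1" "int_count {} a t = 1"
  by (simp_all add: pos_count_def nonneg_count_def int_count_def coord_points_def)

lemma finite_nat_le_real: "finite {q::nat. real q \<le> x}"
  by (rule finite_subset[of _ "{..nat \<lfloor>x\<rfloor>}"]) (auto simp: le_nat_floor)

lemma finite_int_le_real: "finite {q::int. \<bar>real_of_int q\<bar> \<le> x}"
proof (rule finite_subset)
  show "{q::int. \<bar>real_of_int q\<bar> \<le> x} \<subseteq> {-\<lceil>x\<rceil>..\<lceil>x\<rceil>}"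
  proof
    fix q :: int assume "q \<in> {q. \<bar>real_of_int q\<bar> \<le> x}"
    hence "\<bar>real_of_int q\<bar> \<le> x" by simp
    thus "q \<in> {-\<lceil>x\<rceil>..\<lceil>x\<rceil>}" by (simp add: abs_le_iff) linarith
  qed
qed simp

lemma pos_count_insert:
  assumes "finite S" "j \<notin> S" "\<And>i. i \<in> insert j S \<Longrightarrow> 0 < a i" "0 \<le> t"
  shows "pos_count (insert j S) a t =
    (\<Sum>q | 1 \<le> q \<and> real q \<le> a j * t. pos_count S a (slice_radius (a j) t (real q)))"
proof -
  have "finite {q. q \<in> {1..} \<and> \<bar>real q\<bar> \<le> x}" for x
    by (rule finite_subset[OF _ finite_nat_le_real[of x]]) auto
  hence "card (coord_points real {1..} (insert j S) a t) =
    (\<Sum>q | q \<in> {1..} \<and> \<bar>real q\<bar> \<le> a j * t. card (coord_points real {1..} S a (sqrt (t\<^sup>2 - (real q)\<^sup>2 / (a j)\<^sup>2))))"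
    by (intro card_coord_points_insert assms)
  thus ?thesis by (simp add: pos_count_def slice_radius_def)
qed

lemma nonneg_count_insert:
  assumes "finite S" "j \<notin> S" "\<And>i. i \<in> insert j S \<Longrightarrow> 0 < a i" "0 \<le> t"
  shows "nonneg_count (insert j S) a t =
    (\<Sum>q | real q \<le> a j * t. nonneg_count S a (slice_radius (a j) t (real q)))"
proof -
  have "finite {q. q \<in> UNIV \<and> \<bar>real q\<bar> \<le> x}" for x
    by (rule finite_subset[OF _ finite_nat_le_real[of x]]) auto
  hence "card (coord_points real UNIV (insert j S) a t) =
    (\<Sum>q | q \<in> UNIV \<and> \<bar>real q\<bar> \<le> a j * t. card (coord_points real UNIV S a (sqrt (t\<^sup>2 - (real q)\<^sup>2 / (a j)\<^sup>2))))"
    by (intro card_coord_points_insert assms)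
  thus ?thesis by (simp add: nonneg_count_def slice_radius_def)
qed

lemma slice_radius_0 [simp]: "0 \<le> t \<Longrightarrow> slice_radius b t 0 = t"
  by (simp add: slice_radius_def)

lemma sum_nonneg_slices:
  fixes h :: "real \<Rightarrow> real"
  assumes "0 \<le> A"
  shows "(\<Sum>q | real q \<le> A. h (real q)) = h 0 + (\<Sum>q | 1 \<le> q \<and> real q \<le> A. h (real q))"
proof -
  have "{q. real q \<le> A} = insert 0 {q. 1 \<le> q \<and> real q \<le> A}"
    using assms by (auto simp: not_less_eq_eq)
  moreover have "finite {q. 1 \<le> q \<and> real q \<le> A}"
    by (rule finite_subset[OF _ finite_nat_le_real[of A]]) auto
  ultimately show ?thesis by simp
qed

lemma sum_int_slices:
  fixes h :: "real \<Rightarrow> real"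
  assumes "0 \<le> A" "\<And>x. h (-x) = h x"
  shows "(\<Sum>q | \<bar>real_of_int q\<bar> \<le> A. h (real_of_int q)) = h 0 + 2 * (\<Sum>q | 1 \<le> q \<and> real q \<le> A. h (real q))"
proof -
  let ?P = "{q::nat. 1 \<le> q \<and> real q \<le> A}"
  have fin: "finite ?P"
    by (rule finite_subset[OF _ finite_nat_le_real[of A]]) auto
  have eq: "{q. \<bar>real_of_int q\<bar> \<le> A} = {0} \<union> (int ` ?P \<union> (\<lambda>q. - int q) ` ?P)"
  proof (intro equalityI subsetI)
    fix q :: int assume q: "q \<in> {q. \<bar>real_of_int q\<bar> \<le> A}"
    consider "q = 0" | "q > 0" | "q < 0" by linarith
    thus "q \<in> {0} \<union> (int ` ?P \<union> (\<lambda>q. - int q) ` ?P)"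
    proof cases
      case 2
      hence "q = int (nat q)" "nat q \<in> ?P" using q by auto
      thus ?thesis by blast
    next
      case 3
      hence "q = - int (nat (-q))" "nat (-q) \<in> ?P" using q by auto
      thus ?thesis by blast
    qed simp
  qed (use assms in auto)
  have "(\<Sum>q | \<bar>real_of_int q\<bar> \<le> A. h (real_of_int q)) =
     h 0 + ((\<Sum>q\<in>int ` ?P. h (real_of_int q)) + (\<Sum>q\<in>(\<lambda>q. - int q) ` ?P. h (real_of_int q)))"
    unfolding eq using fin by (subst sum.union_disjoint; (subst sum.union_disjoint)?) auto
  also have "(\<Sum>q\<in>int ` ?P. h (real_of_int q)) = (\<Sum>q\<in>?P. h (real q))"
    by (subst sum.reindex) (auto simp: inj_on_def)
  also have "(\<Sum>q\<in>(\<lambda>q. - int q) ` ?P. h (real_of_int q)) = (\<Sum>q\<in>?P. h (real q))"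
    by (subst sum.reindex) (auto simp: inj_on_def assms)
  finally show ?thesis by simp
qed

lemma int_count_insert:
  assumes "finite S" "j \<notin> S" "\<And>i. i \<in> insert j S \<Longrightarrow> 0 < a i" "0 \<le> t"
  shows "int_count (insert j S) a t = int_count S a t +
    2 * (\<Sum>q | 1 \<le> q \<and> real q \<le> a j * t. int_count S a (slice_radius (a j) t (real q)))"
proof -
  have "finite {q. q \<in> UNIV \<and> \<bar>real_of_int q\<bar> \<le> x}" for x
    using finite_int_le_real by simp
  hence "card (coord_points real_of_int UNIV (insert j S) a t) =
    (\<Sum>q | q \<in> UNIV \<and> \<bar>real_of_int q\<bar> \<le> a j * t. card (coord_points real_of_int UNIV S a (sqrt (t\<^sup>2 - (real_of_int q)\<^sup>2 / (a j)\<^sup>2))))"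
    by (intro card_coord_points_insert assms)
  hence "int_count (insert j S) a t =
    (\<Sum>q | \<bar>real_of_int q\<bar> \<le> a j * t. int_count S a (slice_radius (a j) t (real_of_int q)))"
    by (simp add: int_count_def slice_radius_def)
  also have "\<dots> = int_count S a (slice_radius (a j) t 0) +
    2 * (\<Sum>q | 1 \<le> q \<and> real q \<le> a j * t. int_count S a (slice_radius (a j) t (real q)))"
    using assms(3)[of j] assms(4) by (intro sum_int_slices) (auto simp: slice_radius_def)
  finally show ?thesis using assms by simp
qed

text \<open>Points are sorted by their set T of nonzero coordinates. A nonzero coordinate arises
  from a positive one in \<open>w\<close> ways: 2 for integers, by sign, and 1 for naturals. The
  recursion for \<open>F\<close> separates j being zero from j being nonzero.\<close>

lemma subset_expansion:
  fixes F :: "nat set \<Rightarrow> real \<Rightarrow> real" and w :: real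
  assumes F0: "\<And>t. F {} t = 1"
    and F: "\<And>S j t. finite S \<Longrightarrow> j \<notin> S \<Longrightarrow> (\<And>i. i \<in> insert j S \<Longrightarrow> 0 < a i) \<Longrightarrow> 0 \<le> t \<Longrightarrow>
      F (insert j S) t = F S t + w * (\<Sum>q | 1 \<le> q \<and> real q \<le> a j * t. F S (slice_radius (a j) t (real q)))"
    and "finite S" and "\<And>j. j \<in> S \<Longrightarrow> 0 < a j" "0 \<le> t"
  shows "F S t = (\<Sum>T\<in>Pow S. w ^ card T * pos_count T a t)"
  using assms(3-)
proof (induction S arbitrary: t rule: finite_induct)
  case empty
  show ?case by (simp add: F0)
next
  case (insert j S)
  let ?Q = "{q::nat. 1 \<le> q \<and> real q \<le> a j * t}" and ?s = "\<lambda>q::nat. slice_radius (a j) t (real q)"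
  have s: "0 \<le> ?s q" if "q \<in> ?Q" for q
  proof -
    have "(real q)\<^sup>2 \<le> (a j * t)\<^sup>2" using that by (intro power_mono) auto
    thus ?thesis using insert.prems(1)[of j] by (simp add: slice_radius_def field_simps)
  qed
  have IH: "F S u = (\<Sum>T\<in>Pow S. w ^ card T * pos_count T a u)" if "0 \<le> u" for u
    using insert that by auto
  have "F (insert j S) t = F S t + w * (\<Sum>q\<in>?Q. F S (?s q))"
    using insert by (intro F) auto
  also have "(\<Sum>q\<in>?Q. F S (?s q)) = (\<Sum>q\<in>?Q. \<Sum>T\<in>Pow S. w ^ card T * pos_count T a (?s q))"
    using IH s by (intro sum.cong) auto
  also have "\<dots> = (\<Sum>T\<in>Pow S. w ^ card T * (\<Sum>q\<in>?Q. pos_count T a (?s q)))"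
    unfolding sum_distrib_left by (rule sum.swap)
  also have "\<dots> = (\<Sum>T\<in>Pow S. w ^ card T * pos_count (insert j T) a t)"
  proof (intro sum.cong refl arg_cong2[where f="(*)"])
    fix T assume T: "T \<in> Pow S"
    hence "finite T" "j \<notin> T" using insert.hyps finite_subset by auto
    thus "(\<Sum>q\<in>?Q. pos_count T a (?s q)) = pos_count (insert j T) a t"
      using T insert.prems by (intro pos_count_insert[symmetric]) auto
  qed
  also have "w * \<dots> = (\<Sum>T\<in>Pow S. w ^ card (insert j T) * pos_count (insert j T) a t)"
    unfolding sum_distrib_left
  proof (intro sum.cong refl)
    fix T assume "T \<in> Pow S"
    hence "finite T" "j \<notin> T" using insert.hyps finite_subset by auto
    thus "w * (w ^ card T * pos_count (insert j T) a t) = w ^ card (insert j T) * pos_count (insert j T) a t"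
      by simp
  qed
  also have "\<dots> = (\<Sum>T\<in>insert j ` Pow S. w ^ card T * pos_count T a t)"
    using insert.hyps by (subst sum.reindex) (auto simp: inj_on_def)
  also have "F S t + \<dots> = (\<Sum>T\<in>Pow (insert j S). w ^ card T * pos_count T a t)"
    unfolding IH[OF insert.prems(2)] Pow_insert using insert.hyps
    by (subst sum.union_disjoint) auto
  finally show ?case .
qed

lemma int_count_eq:
  assumes "finite S" "\<And>j. j \<in> S \<Longrightarrow> 0 < a j" "0 \<le> t"
  shows "int_count S a t = (\<Sum>T\<in>Pow S. 2 ^ card T * pos_count T a t)"
  by (rule subset_expansion[where F = "\<lambda>S. int_count S a", OF _ int_count_insert assms]) auto

lemma nonneg_count_eq:
  assumes "finite S" "\<And>j. j \<in> S \<Longrightarrow> 0 < a j" "0 \<le> t"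
  shows "nonneg_count S a t = (\<Sum>T\<in>Pow S. pos_count T a t)"
proof -
  have "nonneg_count S a t = (\<Sum>T\<in>Pow S. 1 ^ card T * pos_count T a t)"
  proof (rule subset_expansion[where F = "\<lambda>S. nonneg_count S a", OF _ _ assms])
    fix S j and t :: real
    assume S: "finite S" "j \<notin> S" "\<And>i. i \<in> insert j S \<Longrightarrow> 0 < a i" "0 \<le> t"
    have "nonneg_count (insert j S) a t = (\<Sum>q | real q \<le> a j * t. nonneg_count S a (slice_radius (a j) t (real q)))"
      using S by (intro nonneg_count_insert) auto
    also have "\<dots> = nonneg_count S a (slice_radius (a j) t 0) +
        (\<Sum>q | 1 \<le> q \<and> real q \<le> a j * t. nonneg_count S a (slice_radius (a j) t (real q)))"
      using S(3)[of j] S(4) by (intro sum_nonneg_slices) auto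
    finally show "nonneg_count (insert j S) a t = nonneg_count S a t +
        1 * (\<Sum>q | 1 \<le> q \<and> real q \<le> a j * t. nonneg_count S a (slice_radius (a j) t (real q)))"
      using S by simp
  qed auto
  thus ?thesis by simp
qed

section \<open>Volume bounds with surface terms\<close>

definition orthant_volume :: "nat set \<Rightarrow> (nat \<Rightarrow> real) \<Rightarrow> real \<Rightarrow> real" where
  "orthant_volume S a t = unit_ball_vol (real (card S)) / 2 ^ card S * t ^ card S * (\<Prod>j\<in>S. a j)"

lemma orthant_volume_empty [simp]: "orthant_volume {} a t = 1"
  by (simp add: orthant_volume_def unit_ball_vol_def)

lemma orthant_volume_insert:
  assumes "finite S" "j \<notin> S"
  shows "orthant_volume (insert j S) a t = orthant_volume S a t * (a j * t * ball_ratio (card S))"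
proof -
  have "unit_ball_vol (real (card S)) \<noteq> 0" using unit_ball_vol_pos[of "real (card S)"] by linarith
  thus ?thesis using assms by (simp add: orthant_volume_def ball_ratio_def field_simps)
qed

lemma orthant_volume_nonneg:
  "0 \<le> t \<Longrightarrow> (\<And>j. j \<in> S \<Longrightarrow> 0 < a j) \<Longrightarrow> 0 \<le> orthant_volume S a t"
  unfolding orthant_volume_def by (intro mult_nonneg_nonneg prod_nonneg) (auto simp: less_imp_le)

lemma slice_radius_eq:
  assumes "0 < b" "0 < t"
  shows "slice_radius b t x = t * sqrt (1 - (x / (b * t))\<^sup>2)"
proof -
  have "t\<^sup>2 - x\<^sup>2 / b\<^sup>2 = t\<^sup>2 * (1 - (x / (b * t))\<^sup>2)"
    using assms by (simp add: field_simps)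
  thus ?thesis using assms by (simp add: slice_radius_def real_sqrt_mult)
qed

lemma orthant_volume_slice:
  assumes "0 < b" "0 < t" "0 \<le> x" "x \<le> b * t"
  shows "orthant_volume S a (slice_radius b t x) = orthant_volume S a t * ball_profile (card S) (x / (b * t))"
  using assms by (simp add: orthant_volume_def slice_radius_eq ball_profile_def power_mult_distrib)

lemma slice_radius_nonneg:
  assumes "0 < b" "0 \<le> x" "x \<le> b * t"
  shows "0 \<le> slice_radius b t x"
proof -
  have "x\<^sup>2 \<le> (b * t)\<^sup>2" using assms by (intro power_mono) auto
  thus ?thesis using assms(1) by (simp add: slice_radius_def field_simps)
qed

lemma sum_pos_slices_profile:
  assumes "0 < A" "A \<le> real N"
  shows "(\<Sum>q | 1 \<le> q \<and> real q \<le> A. ball_profile m (real q / A)) = (\<Sum>i<N. ball_profile m ((real i + 1) / A))"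
proof -
  have "(\<Sum>q | 1 \<le> q \<and> real q \<le> A. ball_profile m (real q / A)) = (\<Sum>q\<in>{1..N}. ball_profile m (real q / A))"
  proof (rule sum.mono_neutral_left)
    show "{q. 1 \<le> q \<and> real q \<le> A} \<subseteq> {1..N}"
    proof
      fix q assume "q \<in> {q. 1 \<le> q \<and> real q \<le> A}"
      hence "1 \<le> q" "real q \<le> real N" using assms by auto
      thus "q \<in> {1..N}" by simp
    qed
    show "\<forall>i\<in>{1..N} - {q. 1 \<le> q \<and> real q \<le> A}. ball_profile m (real i / A) = 0"
      using assms by (auto simp: ball_profile_def)
  qed simp
  also have "{1..N} = Suc ` {..<N}" by (simp add: image_Suc_lessThan)
  also have "(\<Sum>q\<in>Suc ` {..<N}. ball_profile m (real q / A)) = (\<Sum>i<N. ball_profile m ((real i + 1) / A))"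
    by (subst sum.reindex) (auto simp: add.commute)
  finally show ?thesis .
qed

text \<open>The inequality is strict because an integer q = A belongs to the sum on the left, and
  for \<open>m = 0\<close> its term is 1.\<close>

lemma sum_nonneg_slices_profile:
  assumes "0 < A" "A < real N"
  shows "(\<Sum>q | real q \<le> A. ball_profile m (real q / A)) = (\<Sum>i<N. ball_profile m (real i / A))"
proof (rule sum.mono_neutral_left)
  show "{q. real q \<le> A} \<subseteq> {..<N}"
  proof
    fix q assume "q \<in> {q. real q \<le> A}"
    hence "real q < real N" using assms by auto
    thus "q \<in> {..<N}" by simp
  qed
  show "\<forall>i\<in>{..<N} - {q. real q \<le> A}. ball_profile m (real i / A) = 0"
    using assms by (auto simp: ball_profile_def)
qed simp

lemma sum_pos_slices_volume:
  assumes "0 < b" "0 < t"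
  shows "(\<Sum>q | 1 \<le> q \<and> real q \<le> b * t. orthant_volume S a (slice_radius b t (real q))) =
    orthant_volume S a t * (\<Sum>q | 1 \<le> q \<and> real q \<le> b * t. ball_profile (card S) (real q / (b * t)))"
  unfolding sum_distrib_left using assms by (intro sum.cong refl orthant_volume_slice) auto

lemma sum_nonneg_slices_volume:
  assumes "0 < b" "0 < t"
  shows "(\<Sum>q | real q \<le> b * t. orthant_volume S a (slice_radius b t (real q))) =
    orthant_volume S a t * (\<Sum>q | real q \<le> b * t. ball_profile (card S) (real q / (b * t)))"
  unfolding sum_distrib_left using assms by (intro sum.cong refl orthant_volume_slice) auto

lemma sum_pos_slices_bounds:
  assumes "0 < A"
  shows "(\<Sum>q | 1 \<le> q \<and> real q \<le> A. ball_profile m (real q / A)) \<le> A * ball_ratio m"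
    and "A * ball_ratio m - 1 \<le> (\<Sum>q | 1 \<le> q \<and> real q \<le> A. ball_profile m (real q / A))"
    and "1 \<le> m \<Longrightarrow> 1 \<le> A \<Longrightarrow>
      (\<Sum>q | 1 \<le> q \<and> real q \<le> A. ball_profile m (real q / A)) + sum_defect m \<le> A * ball_ratio m"
proof -
  obtain N where N: "A \<le> real N" using real_arch_simple by blast
  show "(\<Sum>q | 1 \<le> q \<and> real q \<le> A. ball_profile m (real q / A)) \<le> A * ball_ratio m"
    "A * ball_ratio m - 1 \<le> (\<Sum>q | 1 \<le> q \<and> real q \<le> A. ball_profile m (real q / A))"
    "1 \<le> m \<Longrightarrow> 1 \<le> A \<Longrightarrow>
      (\<Sum>q | 1 \<le> q \<and> real q \<le> A. ball_profile m (real q / A)) + sum_defect m \<le> A * ball_ratio m"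
    unfolding sum_pos_slices_profile[OF assms N]
    using ball_profile_sum_bounds[OF assms N] ball_profile_sum_upper_defect[OF _ _ N] by auto
qed

lemma sum_nonneg_slices_bounds:
  assumes "0 < A"
  shows "A * ball_ratio m \<le> (\<Sum>q | real q \<le> A. ball_profile m (real q / A))"
    and "1 \<le> m \<Longrightarrow> A * ball_ratio m + sum_defect m \<le> (\<Sum>q | real q \<le> A. ball_profile m (real q / A))"
proof -
  obtain N where N: "A < real N" using reals_Archimedean2 by blast
  show "A * ball_ratio m \<le> (\<Sum>q | real q \<le> A. ball_profile m (real q / A))"
    "1 \<le> m \<Longrightarrow> A * ball_ratio m + sum_defect m \<le> (\<Sum>q | real q \<le> A. ball_profile m (real q / A))"
    unfolding sum_nonneg_slices_profile[OF assms N]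
    using ball_profile_sum_bounds[OF assms] ball_profile_sum_lower_defect[OF _ assms] N by auto
qed

lemma pos_count_insert_0:
  assumes "finite S" "j \<notin> S" "\<And>i. i \<in> insert j S \<Longrightarrow> 0 < a i"
  shows "pos_count (insert j S) a 0 = 0"
proof -
  have "{q. 1 \<le> q \<and> real q \<le> a j * 0} = {}" by auto
  thus ?thesis using pos_count_insert[of S j a 0] assms by simp
qed

lemma orthant_volume_insert_0:
  "finite S \<Longrightarrow> j \<notin> S \<Longrightarrow> orthant_volume (insert j S) a 0 = 0"
  by (simp add: orthant_volume_def)

text \<open>Slices at q >= 1 form a right-endpoint sum of a decreasing profile, so each direction
  can only lose volume. No threshold for t enters.\<close>

lemma pos_count_le_volume:
  assumes "finite S" "\<And>j. j \<in> S \<Longrightarrow> 0 < a j" "0 \<le> t"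
  shows "pos_count S a t \<le> orthant_volume S a t"
  using assms
proof (induction S arbitrary: t rule: finite_induct)
  case (insert j S)
  have aj: "0 < a j" using insert.prems by simp
  show ?case
  proof (cases "t = 0")
    case True
    moreover have "pos_count (insert j S) a 0 = 0"
      using insert.hyps insert.prems by (intro pos_count_insert_0) auto
    ultimately show ?thesis using insert.hyps by (simp add: orthant_volume_insert_0)
  next
    case False
    hence t: "0 < t" using insert.prems by simp
    have "pos_count (insert j S) a t = (\<Sum>q | 1 \<le> q \<and> real q \<le> a j * t. pos_count S a (slice_radius (a j) t (real q)))"
      using insert by (intro pos_count_insert) auto
    also have "\<dots> \<le> (\<Sum>q | 1 \<le> q \<and> real q \<le> a j * t. orthant_volume S a (slice_radius (a j) t (real q)))"
      using insert aj by (intro sum_mono insert.IH) (auto intro: slice_radius_nonneg)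
    also have "\<dots> = orthant_volume S a t * (\<Sum>q | 1 \<le> q \<and> real q \<le> a j * t. ball_profile (card S) (real q / (a j * t)))"
      by (rule sum_pos_slices_volume[OF aj t])
    also have "\<dots> \<le> orthant_volume S a t * (a j * t * ball_ratio (card S))"
      using insert.prems t aj by (intro mult_left_mono sum_pos_slices_bounds orthant_volume_nonneg) auto
    also have "\<dots> = orthant_volume (insert j S) a t" using insert by (simp add: orthant_volume_insert)
    finally show ?thesis .
  qed
qed simp

text \<open>The gain is taken in direction j alone, where the volume of the orthogonal face
  \<open>S\<close> appears as a factor; all other directions use the bound without gain. Nonempty
  \<open>S\<close> gives the profile a positive exponent.\<close>

lemma pos_count_insert_le_volume_defect:
  assumes S: "finite S" "S \<noteq> {}" "j \<notin> S" "\<And>i. i \<in> insert j S \<Longrightarrow> 0 < a i" and t: "1 \<le> a j * t" "0 < t"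
  shows "pos_count (insert j S) a t + sum_defect (card S) * orthant_volume S a t \<le> orthant_volume (insert j S) a t"
proof -
  have aj: "0 < a j" using S by simp
  have m: "card S \<ge> 1" using S by (simp add: Suc_le_eq card_gt_0_iff)
  have "pos_count (insert j S) a t = (\<Sum>q | 1 \<le> q \<and> real q \<le> a j * t. pos_count S a (slice_radius (a j) t (real q)))"
    using S t by (intro pos_count_insert) auto
  also have "\<dots> \<le> (\<Sum>q | 1 \<le> q \<and> real q \<le> a j * t. orthant_volume S a (slice_radius (a j) t (real q)))"
    using S aj by (intro sum_mono pos_count_le_volume) (auto intro: slice_radius_nonneg)
  also have "\<dots> = orthant_volume S a t * (\<Sum>q | 1 \<le> q \<and> real q \<le> a j * t. ball_profile (card S) (real q / (a j * t)))"
    by (rule sum_pos_slices_volume[OF aj t(2)])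
  also have "\<dots> \<le> orthant_volume S a t * (a j * t * ball_ratio (card S) - sum_defect (card S))"
    using S t aj m sum_pos_slices_bounds(3)[of "a j * t" "card S"]
    by (intro mult_left_mono orthant_volume_nonneg) auto
  also have "\<dots> = orthant_volume (insert j S) a t - sum_defect (card S) * orthant_volume S a t"
    using S by (simp add: orthant_volume_insert algebra_simps)
  finally show ?thesis by simp
qed

lemma nonneg_count_ge_volume:
  assumes "finite S" "\<And>j. j \<in> S \<Longrightarrow> 0 < a j" "0 \<le> t"
  shows "orthant_volume S a t \<le> nonneg_count S a t"
  using assms
proof (induction S arbitrary: t rule: finite_induct)
  case (insert j S)
  have aj: "0 < a j" using insert.prems by simp
  show ?case
  proof (cases "t = 0")
    case True
    thus ?thesis using insert by (simp add: nonneg_count_def orthant_volume_insert_0)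
  next
    case False
    hence t: "0 < t" using insert.prems by simp
    have "orthant_volume (insert j S) a t = orthant_volume S a t * (a j * t * ball_ratio (card S))"
      using insert by (simp add: orthant_volume_insert)
    also have "\<dots> \<le> orthant_volume S a t * (\<Sum>q | real q \<le> a j * t. ball_profile (card S) (real q / (a j * t)))"
      using insert.prems t aj by (intro mult_left_mono sum_nonneg_slices_bounds orthant_volume_nonneg) auto
    also have "\<dots> = (\<Sum>q | real q \<le> a j * t. orthant_volume S a (slice_radius (a j) t (real q)))"
      by (rule sum_nonneg_slices_volume[OF aj t, symmetric])
    also have "\<dots> \<le> (\<Sum>q | real q \<le> a j * t. nonneg_count S a (slice_radius (a j) t (real q)))"
      using insert aj by (intro sum_mono insert.IH) (auto intro: slice_radius_nonneg)
    also have "\<dots> = nonneg_count (insert j S) a t"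
      using insert by (intro nonneg_count_insert[symmetric]) auto
    finally show ?thesis .
  qed
qed simp

text \<open>The same mechanism with left-endpoint sums. Nothing ties t to \<open>a j\<close>, so
  arbitrarily thin cuboids are covered.\<close>

lemma nonneg_count_insert_ge_volume_defect:
  assumes S: "finite S" "S \<noteq> {}" "j \<notin> S" "\<And>i. i \<in> insert j S \<Longrightarrow> 0 < a i" and t: "0 < t"
  shows "orthant_volume (insert j S) a t + sum_defect (card S) * orthant_volume S a t \<le> nonneg_count (insert j S) a t"
proof -
  have aj: "0 < a j" using S by simp
  have m: "card S \<ge> 1" using S by (simp add: Suc_le_eq card_gt_0_iff)
  have "orthant_volume (insert j S) a t + sum_defect (card S) * orthant_volume S a t =
      orthant_volume S a t * (a j * t * ball_ratio (card S) + sum_defect (card S))"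
    using S by (simp add: orthant_volume_insert algebra_simps)
  also have "\<dots> \<le> orthant_volume S a t * (\<Sum>q | real q \<le> a j * t. ball_profile (card S) (real q / (a j * t)))"
    using S t aj m by (intro mult_left_mono sum_nonneg_slices_bounds(2) orthant_volume_nonneg) auto
  also have "\<dots> = (\<Sum>q | real q \<le> a j * t. orthant_volume S a (slice_radius (a j) t (real q)))"
    by (rule sum_nonneg_slices_volume[OF aj t, symmetric])
  also have "\<dots> \<le> (\<Sum>q | real q \<le> a j * t. nonneg_count S a (slice_radius (a j) t (real q)))"
    using S aj by (intro sum_mono nonneg_count_ge_volume) (auto intro: slice_radius_nonneg)
  also have "\<dots> = nonneg_count (insert j S) a t"
    using S t by (intro nonneg_count_insert[symmetric]) auto
  finally show ?thesis .
qed

text \<open>The slice at height 0 is the largest one and has the volume of the face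
  \<open>S\<close>, so leaving it out costs at most that face.\<close>

lemma sum_pos_slices_volume_bounds:
  assumes S: "finite S" "j \<notin> S" "\<And>i. i \<in> insert j S \<Longrightarrow> 0 < a i" and t: "0 < t"
  shows "(\<Sum>q | 1 \<le> q \<and> real q \<le> a j * t. orthant_volume S a (slice_radius (a j) t (real q))) \<le> orthant_volume (insert j S) a t"
    and "orthant_volume (insert j S) a t - orthant_volume S a t \<le>
      (\<Sum>q | 1 \<le> q \<and> real q \<le> a j * t. orthant_volume S a (slice_radius (a j) t (real q)))"
proof -
  have aj: "0 < a j" using S by simp
  have V: "0 \<le> orthant_volume S a t" using S t by (intro orthant_volume_nonneg) auto
  show "(\<Sum>q | 1 \<le> q \<and> real q \<le> a j * t. orthant_volume S a (slice_radius (a j) t (real q))) \<le> orthant_volume (insert j S) a t"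
    unfolding sum_pos_slices_volume[OF aj t] orthant_volume_insert[OF S(1,2)]
    using V aj t by (intro mult_left_mono sum_pos_slices_bounds) auto
  have "orthant_volume (insert j S) a t - orthant_volume S a t = orthant_volume S a t * (a j * t * ball_ratio (card S) - 1)"
    unfolding orthant_volume_insert[OF S(1,2)] by (simp add: algebra_simps)
  also have "\<dots> \<le> (\<Sum>q | 1 \<le> q \<and> real q \<le> a j * t. orthant_volume S a (slice_radius (a j) t (real q)))"
    unfolding sum_pos_slices_volume[OF aj t] 
    using V aj t by (intro mult_left_mono sum_pos_slices_bounds) auto
  finally show "orthant_volume (insert j S) a t - orthant_volume S a t \<le>
      (\<Sum>q | 1 \<le> q \<and> real q \<le> a j * t. orthant_volume S a (slice_radius (a j) t (real q)))" .
qed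

text \<open>
  Only points with some coordinate below \<open>1\<close> can fail to be covered by the unit cubes above the
  lattice points; projecting along that coordinate bounds their volume by a face.
\<close>

lemma pos_count_ge_volume:
  assumes "finite S" "\<And>j. j \<in> S \<Longrightarrow> 0 < a j" "0 \<le> t"
  shows "orthant_volume S a t - (\<Sum>j\<in>S. orthant_volume (S - {j}) a t) \<le> pos_count S a t"
  using assms
proof (induction S arbitrary: t rule: finite_induct)
  case (insert j S)
  have aj: "0 < a j" using insert.prems by simp
  show ?case
  proof (cases "t = 0")
    case True
    moreover have "0 \<le> (\<Sum>k\<in>insert j S. orthant_volume (insert j S - {k}) a t)"
      using insert.prems by (intro sum_nonneg orthant_volume_nonneg) auto
    ultimately show ?thesis
      using insert by (simp add: orthant_volume_insert_0 pos_count_def del: sum.insert)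
  next
    case False
    hence t: "0 < t" using insert.prems by simp
    let ?Q = "{q::nat. 1 \<le> q \<and> real q \<le> a j * t}" and ?s = "\<lambda>q::nat. slice_radius (a j) t (real q)"
    \<comment> \<open>A face omitting some k in S is the sum of its own slices, where an upper bound
      suffices; the face omitting j pays for the missing slice at height 0.\<close>
    have k: "(\<Sum>q\<in>?Q. orthant_volume (S - {k}) a (?s q)) \<le> orthant_volume (insert j S - {k}) a t" if "k \<in> S" for k
    proof -
      have "insert j S - {k} = insert j (S - {k})" using that insert.hyps by auto
      thus ?thesis using sum_pos_slices_volume_bounds(1)[of "S - {k}" j a t] insert t by auto
    qed
    have "orthant_volume (insert j S) a t - (\<Sum>k\<in>insert j S. orthant_volume (insert j S - {k}) a t) =
       (orthant_volume (insert j S) a t - orthant_volume S a t) - (\<Sum>k\<in>S. orthant_volume (insert j S - {k}) a t)"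
      using insert.hyps by simp
    also have "\<dots> \<le> (\<Sum>q\<in>?Q. orthant_volume S a (?s q)) - (\<Sum>k\<in>S. \<Sum>q\<in>?Q. orthant_volume (S - {k}) a (?s q))"
      using insert t k by (intro diff_mono sum_pos_slices_volume_bounds sum_mono) auto
    also have "\<dots> = (\<Sum>q\<in>?Q. orthant_volume S a (?s q) - (\<Sum>k\<in>S. orthant_volume (S - {k}) a (?s q)))"
      unfolding sum_subtractf by (subst (2) sum.swap) simp
    also have "\<dots> \<le> (\<Sum>q\<in>?Q. pos_count S a (?s q))"
      using insert aj by (intro sum_mono insert.IH) (auto intro: slice_radius_nonneg)
    also have "\<dots> = pos_count (insert j S) a t"
      using insert by (intro pos_count_insert[symmetric]) auto
    finally show ?thesis .
  qed
qed simp

section \<open>Eigenvalue listings and attained optima\<close>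

definition sublevel :: "'i set \<Rightarrow> ('i \<Rightarrow> real) \<Rightarrow> real \<Rightarrow> 'i set" where
  "sublevel I f x = {i \<in> I. f i \<le> x}"

text \<open>Monotonicity makes the positions with value at most x an initial segment, and b maps it
  bijectively onto the sublevel set, which fixes its length.\<close>

lemma listing_le_iff_aux:
  fixes f :: "'i \<Rightarrow> real"
  assumes fin: "finite (sublevel I f x)"
    and e: "incseq e" "bij_betw b UNIV I" "\<And>k. e k = f (b k)"
  shows "e k \<le> x \<longleftrightarrow> k < card (sublevel I f x)"
proof -
  have inj: "inj b" using e(2) by (simp add: bij_betw_def)
  have im: "b ` {k. e k \<le> x} = sublevel I f x"
    using e(2) by (fastforce simp: sublevel_def e(3) bij_betw_def)
  have f: "finite {k. e k \<le> x}"
    by (rule finite_imageD[of b]) (simp_all add: im fin inj_on_subset[OF inj subset_UNIV])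
  have c: "card (sublevel I f x) = card {k. e k \<le> x}"
    unfolding im[symmetric] by (rule card_image) (rule inj_on_subset[OF inj subset_UNIV])
  have down: "j \<in> {k. e k \<le> x}" if "l \<in> {k. e k \<le> x}" "j \<le> l" for j l
    using that e(1) by (auto simp: incseq_def intro: order_trans)
  have "{k. e k \<le> x} = {..<card {k. e k \<le> x}}"
  proof (cases "{k. e k \<le> x} = {}")
    case False
    define m where "m = Max {k. e k \<le> x}"
    have "m \<in> {k. e k \<le> x}" unfolding m_def using f False by (rule Max_in)
    moreover have "j \<le> m" if "j \<in> {k. e k \<le> x}" for j unfolding m_def using f that by (rule Max_ge)
    ultimately have "{k. e k \<le> x} = {..m}" using down by blast
    thus ?thesis by (simp add: lessThan_Suc_atMost)
  qed simp
  thus ?thesis unfolding c by blast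
qed

lemma listing_exists:
  fixes f :: "'i \<Rightarrow> real"
  assumes inf: "infinite I" and fin: "\<And>x. finite (sublevel I f x)"
  shows "\<exists>b. bij_betw b (UNIV :: nat set) I \<and> incseq (\<lambda>k. f (b k))"
proof -
  have least: "\<exists>i. i \<in> I - A \<and> (\<forall>j\<in>I - A. f i \<le> f j)" if "finite A" for A
  proof -
    have "infinite (I - A)" using Diff_infinite_finite[OF that inf] .
    then obtain j where j: "j \<in> I - A" using infinite_imp_nonempty by blast
    have "finite (sublevel I f (f j) - A)" using fin by auto
    moreover have "j \<in> sublevel I f (f j) - A" using j by (auto simp: sublevel_def)
    ultimately obtain i where i: "i \<in> sublevel I f (f j) - A" "\<forall>l\<in>sublevel I f (f j) - A. f i \<le> f l"
      using ex_is_arg_min_if_finite[of "sublevel I f (f j) - A" f] unfolding is_arg_min_linorder by blast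
    hence "f i \<le> f l" if "l \<in> I - A" for l
      using that by (cases "f l \<le> f j") (auto simp: sublevel_def)
    thus ?thesis using i by (auto simp: sublevel_def)
  qed
  define next_elt where "next_elt A = (SOME i. i \<in> I - A \<and> (\<forall>j\<in>I - A. f i \<le> f j))" for A
  have nx: "next_elt A \<in> I - A" "\<And>j. j \<in> I - A \<Longrightarrow> f (next_elt A) \<le> f j" if "finite A" for A
    using someI_ex[OF least[OF that]] unfolding next_elt_def by blast+
  define B where "B = rec_nat {} (\<lambda>_ A. insert (next_elt A) A)"
  define b where "b k = next_elt (B k)" for k
  have B0: "B 0 = {}" and BS: "B (Suc k) = insert (b k) (B k)" for k
    by (auto simp: B_def b_def)
  have B: "B k = b ` {..<k}" for k
    by (induction k) (auto simp: B0 BS lessThan_Suc)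
  have finB: "finite (B k)" for k by (simp add: B)
  have bI: "b k \<in> I" "b k \<notin> B k" "\<And>j. j \<in> I - B k \<Longrightarrow> f (b k) \<le> f j" for k
    using nx[OF finB[of k]] by (auto simp: b_def)
  have inj: "inj b"
  proof (rule linorder_injI)
    fix x y :: nat assume "x < y"
    hence "b x \<in> b ` {..<y}" by blast
    thus "b x \<noteq> b y" using bI(2)[of y] by (auto simp: B)
  qed
  have inc: "incseq (\<lambda>k. f (b k))"
  proof (rule incseq_SucI)
    fix k
    have "b (Suc k) \<in> I - B k" using bI(1,2)[of "Suc k"] by (auto simp: BS)
    thus "f (b k) \<le> f (b (Suc k))" by (rule bI(3))
  qed
  have "i \<in> range b" if "i \<in> I" for i
  proof (rule ccontr)
    assume "i \<notin> range b"
    hence "f (b k) \<le> f i" for k using bI(3)[of i k] that by (auto simp: B)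
    hence "range b \<subseteq> sublevel I f (f i)" using bI(1) by (auto simp: sublevel_def)
    hence "finite (range b)" using fin finite_subset by blast
    thus False using inj finite_imageD by blast
  qed
  hence "bij_betw b UNIV I" using inj bI(1) by (auto simp: bij_betw_def)
  with inc show ?thesis by blast
qed

text \<open>The definite description is unfolded only here; everything later rests on this
  equivalence. It also yields uniqueness, because two listings with the same counting function have
  the same upper bounds at each position.\<close>

lemma nondecreasing_listing_le_iff:
  assumes inf: "infinite I" and fin: "\<And>x. finite (sublevel I f x)"
  shows "nondecreasing_listing I f k \<le> x \<longleftrightarrow> k < card (sublevel I f x)"
proof -
  let ?P = "\<lambda>e. incseq e \<and> (\<exists>b. bij_betw b UNIV I \<and> (\<forall>k::nat. e k = f (b k)))"
  have iff: "e k \<le> x \<longleftrightarrow> k < card (sublevel I f x)" if "?P e" for e k x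
  proof -
    from that obtain b where "incseq e" "bij_betw b UNIV I" "\<forall>k. e k = f (b k)" by (elim conjE exE)
    thus ?thesis by (intro listing_le_iff_aux[of I f x e b k] fin) simp_all
  qed
  have "\<exists>!e. ?P e"
  proof (rule ex_ex1I)
    obtain b where "bij_betw b UNIV I" "incseq (\<lambda>k::nat. f (b k))"
      using listing_exists[OF inf fin] by auto
    thus "\<exists>e. ?P e" by (intro exI[of _ "\<lambda>k. f (b k)"] conjI exI[of _ b]) simp_all
    fix e e' assume P: "?P e" "?P e'"
    have eq: "e k \<le> x \<longleftrightarrow> e' k \<le> x" for k x
      unfolding iff[of e, OF P(1)] iff[of e', OF P(2)] ..
    show "e = e'"
      by (intro ext order.antisym) (rule eq[THEN iffD2, OF order.refl], rule eq[THEN iffD1, OF order.refl])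
  qed
  from theI'[OF this] have "?P (nondecreasing_listing I f)"
    unfolding nondecreasing_listing_def .
  thus ?thesis by (rule iff[of "nondecreasing_listing I f"])
qed

section \<open>Continuity in the side lengths and compactness\<close>

lemma nondecreasing_listing_mono_scale:
  assumes I: "infinite I" "\<And>x. finite (sublevel I f x)" "\<And>x. finite (sublevel I g x)"
    and "0 < c" "\<And>i. i \<in> I \<Longrightarrow> f i \<le> c * g i"
  shows "nondecreasing_listing I f k \<le> c * nondecreasing_listing I g k"
proof -
  let ?x = "nondecreasing_listing I g k"
  have "sublevel I g ?x \<subseteq> sublevel I f (c * ?x)"
  proof
    fix i assume i: "i \<in> sublevel I g ?x"
    hence "f i \<le> c * g i" using assms(5) by (simp add: sublevel_def)
    also have "\<dots> \<le> c * ?x" using i assms(4) by (simp add: sublevel_def)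
    finally show "i \<in> sublevel I f (c * ?x)" using i by (simp add: sublevel_def)
  qed
  hence "card (sublevel I g ?x) \<le> card (sublevel I f (c * ?x))" by (intro card_mono I)
  moreover have "k < card (sublevel I g ?x)"
    by (rule nondecreasing_listing_le_iff[OF I(1,3), THEN iffD1, OF order.refl])
  ultimately have "k < card (sublevel I f (c * ?x))" by simp
  thus ?thesis by (rule nondecreasing_listing_le_iff[OF I(1,2), THEN iffD2])
qed

text \<open>The factor is symmetric in \<open>a\<close> and \<open>b\<close> and tends to 1 as they
  approach each other, so it serves both halves of the continuity estimate.\<close>

lemma mode_eigenvalue_scale:
  assumes "\<And>j. j < n \<Longrightarrow> 0 < a j" "\<And>j. j < n \<Longrightarrow> 0 < b j"
  shows "mode_eigenvalue n a i \<le> exp (2 * (\<Sum>j<n. \<bar>ln (a j) - ln (b j)\<bar>)) * mode_eigenvalue n b i"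
proof -
  define c where "c = exp (2 * (\<Sum>j<n. \<bar>ln (a j) - ln (b j)\<bar>))"
  show ?thesis
    unfolding c_def[symmetric]
    unfolding mode_eigenvalue_def sum_distrib_left
  proof (intro sum_mono)
    fix j assume "j \<in> {..<n}"
    hence j: "0 < a j" "0 < b j" "j < n" using assms by auto
    have "(b j)\<^sup>2 / (a j)\<^sup>2 = exp (2 * (ln (b j) - ln (a j)))"
      using j by (simp add: power_divide exp_double exp_diff)
    also have "\<dots> \<le> c" unfolding c_def
      using member_le_sum[of j "{..<n}" "\<lambda>j. \<bar>ln (a j) - ln (b j)\<bar>"] j by simp
    finally have "(b j)\<^sup>2 / (a j)\<^sup>2 * (pi\<^sup>2 * (real (i j))\<^sup>2 / (b j)\<^sup>2) \<le>
       c * (pi\<^sup>2 * (real (i j))\<^sup>2 / (b j)\<^sup>2)"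
      by (intro mult_right_mono) auto
    thus "pi\<^sup>2 * (real (i j))\<^sup>2 / (a j)\<^sup>2 \<le>
       c * (pi\<^sup>2 * (real (i j))\<^sup>2 / (b j)\<^sup>2)"
      using j by simp
  qed
qed

lemma finite_sublevel_mode_eigenvalue:
  assumes "\<And>j. j < n \<Longrightarrow> 0 < a j" "I \<subseteq> {..<n} \<rightarrow>\<^sub>E UNIV"
  shows "finite (sublevel I (mode_eigenvalue n a) x)"
proof (rule finite_subset)
  show "sublevel I (mode_eigenvalue n a) x \<subseteq> (\<Pi>\<^sub>E j\<in>{..<n}. {q. q \<le> nat \<lceil>sqrt x * a j / pi\<rceil>})"
  proof
    fix i assume i: "i \<in> sublevel I (mode_eigenvalue n a) x"
    have "i j \<le> nat \<lceil>sqrt x * a j / pi\<rceil>" if j: "j < n" for j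
    proof -
      have "pi\<^sup>2 * (real (i j))\<^sup>2 / (a j)\<^sup>2 \<le> mode_eigenvalue n a i"
        unfolding mode_eigenvalue_def
        using member_le_sum[of j "{..<n}" "\<lambda>j. pi\<^sup>2 * (real (i j))\<^sup>2 / (a j)\<^sup>2"] j by simp
      also have "\<dots> \<le> x" using i by (simp add: sublevel_def)
      finally have "(pi * real (i j) / a j)\<^sup>2 \<le> x" by (simp add: power_divide power_mult_distrib)
      hence "pi * real (i j) / a j \<le> sqrt x" by (rule real_le_rsqrt)
      hence "real (i j) \<le> sqrt x * a j / pi" using assms(1)[OF j] by (simp add: field_simps)
      thus ?thesis by linarith
    qed
    moreover have "i \<in> {..<n} \<rightarrow>\<^sub>E UNIV" using i assms(2) by (auto simp: sublevel_def)
    ultimately show "i \<in> (\<Pi>\<^sub>E j\<in>{..<n}. {q. q \<le> nat \<lceil>sqrt x * a j / pi\<rceil>})"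
      by (auto simp: PiE_iff)
  qed
qed (intro finite_PiE; simp)

lemma continuous_on_listing_mode_eigenvalue:
  fixes n :: nat
  assumes I: "infinite I" "I \<subseteq> {..<n} \<rightarrow>\<^sub>E UNIV"
  shows "continuous_on {a. \<forall>j<n. 0 < a j} (\<lambda>a. nondecreasing_listing I (mode_eigenvalue n a) k)"
  unfolding continuous_on_def
proof
  let ?U = "{a :: nat \<Rightarrow> real. \<forall>j<n. 0 < a j}"
  fix a assume a: "a \<in> ?U"
  let ?e = "\<lambda>a. nondecreasing_listing I (mode_eigenvalue n a) k"
  define c where "c x = exp (2 * (\<Sum>j<n. \<bar>ln (x j) - ln (a j)\<bar>))" for x :: "nat \<Rightarrow> real"
  have coord: "((\<lambda>x. x j) \<longlongrightarrow> a j) (at a within ?U)" for j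
    using continuous_on_subset[OF continuous_on_product_coordinates[of j] subset_UNIV, of ?U] a
    unfolding continuous_on_def by (rule bspec)
  have "(c \<longlongrightarrow> exp (2 * (\<Sum>j<n. \<bar>ln (a j) - ln (a j)\<bar>))) (at a within ?U)"
    unfolding c_def by (intro tendsto_intros coord) (use a in auto)
  hence c: "(c \<longlongrightarrow> 1) (at a within ?U)" by simp
  have scale: "?e x \<le> c y * ?e z" if "x \<in> ?U" "z \<in> ?U" "c y = exp (2 * (\<Sum>j<n. \<bar>ln (x j) - ln (z j)\<bar>))" for x y z
    unfolding that(3)
    by (intro nondecreasing_listing_mono_scale I finite_sublevel_mode_eigenvalue mode_eigenvalue_scale)
       (use that in auto)
  \<comment> \<open>Exchanging the roles of x and a in the comparison gives the lower half of the
    sandwich around \<open>?e a\<close>.\<close>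
  have 1: "\<forall>\<^sub>F x in at a within ?U. ?e a / c x \<le> ?e x"
  proof (rule eventually_at_topological[THEN iffD2], intro exI[of _ UNIV] conjI ballI impI)
    fix x assume "x \<in> ?U"
    hence "?e a \<le> c x * ?e x" using a by (intro scale) (auto simp: c_def abs_minus_commute)
    thus "?e a / c x \<le> ?e x" by (simp add: c_def field_simps)
  qed auto
  have 2: "\<forall>\<^sub>F x in at a within ?U. ?e x \<le> c x * ?e a"
  proof (rule eventually_at_topological[THEN iffD2], intro exI[of _ UNIV] conjI ballI impI)
    fix x assume "x \<in> ?U"
    thus "?e x \<le> c x * ?e a" using a by (intro scale) (auto simp: c_def)
  qed auto
  show "(?e \<longlongrightarrow> ?e a) (at a within ?U)"
  proof (rule tendsto_sandwich[OF 1 2])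
    show "((\<lambda>x. ?e a / c x) \<longlongrightarrow> ?e a) (at a within ?U)"
      using tendsto_divide[OF tendsto_const c, of "?e a"] by simp
    show "((\<lambda>x. c x * ?e a) \<longlongrightarrow> ?e a) (at a within ?U)"
      using tendsto_mult[OF c tendsto_const, of "?e a"] by simp
  qed
qed

text \<open>Functions are topologised coordinatewise, so the coordinates from \<open>n\<close> on
  must be pinned down for compactness; 1 is the value that \<open>unit_cube\<close> takes
  there.\<close>

definition cuboid_box :: "nat \<Rightarrow> real \<Rightarrow> real \<Rightarrow> (nat \<Rightarrow> real) set" where
  "cuboid_box n l u = {a \<in> unit_measure_cuboids n. (\<forall>j<n. l \<le> a j \<and> a j \<le> u) \<and> (\<forall>j\<ge>n. a j = 1)}"

lemma compact_cuboid_box: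
  assumes "0 < l" shows "compact (cuboid_box n l u)"
proof -
  have "compactin (product_topology (\<lambda>_. euclidean) UNIV) (Pi\<^sub>E UNIV (\<lambda>j::nat. if j < n then {l..u} else {1::real}))"
    by (auto simp: compactin_PiE)
  hence "compact (Pi\<^sub>E UNIV (\<lambda>j::nat. if j < n then {l..u} else {1::real}))"
    by (simp add: euclidean_product_topology)
  moreover have "closed ((\<lambda>a. \<Prod>j<n. a j) -` {1::real})"
    by (intro closed_vimage continuous_intros)
       (auto intro!: continuous_on_prod continuous_on_product_coordinates)
  ultimately have "compact ((Pi\<^sub>E UNIV (\<lambda>j::nat. if j < n then {l..u} else {1::real})) \<inter> ((\<lambda>a. \<Prod>j<n. a j) -` {1}))"
    by (rule compact_Int_closed)
  moreover have "(Pi\<^sub>E UNIV (\<lambda>j::nat. if j < n then {l..u} else {1::real})) \<inter> ((\<lambda>a. \<Prod>j<n. a j) -` {1}) = cuboid_box n l u"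
  proof (intro equalityI subsetI)
    fix a assume a: "a \<in> (Pi\<^sub>E UNIV (\<lambda>j::nat. if j < n then {l..u} else {1::real})) \<inter> ((\<lambda>a. \<Prod>j<n. a j) -` {1})"
    hence "l \<le> a j \<and> a j \<le> u" if "j < n" for j using that by (auto simp: PiE_iff dest: spec[of _ j])
    moreover have "a j = 1" if "j \<ge> n" for j using that a by (auto simp: PiE_iff dest: spec[of _ j])
    ultimately show "a \<in> cuboid_box n l u" using a assms
      by (auto simp: cuboid_box_def unit_measure_cuboids_def intro: less_le_trans)
  qed (auto simp: cuboid_box_def unit_measure_cuboids_def)
  ultimately show ?thesis by simp
qed

lemma mode_eigenvalue_cong: "(\<And>j. j < n \<Longrightarrow> a j = b j) \<Longrightarrow> mode_eigenvalue n a = mode_eigenvalue n b"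
  by (auto simp: mode_eigenvalue_def fun_eq_iff)

lemma unit_cube_in: "unit_cube \<in> unit_measure_cuboids n"
  by (simp add: unit_cube_def unit_measure_cuboids_def)

lemma unit_cuboid_sides_le:
  assumes a: "a \<in> unit_measure_cuboids n" and l: "0 < l" "\<And>j. j < n \<Longrightarrow> l \<le> a j" and j: "j < n"
  shows "a j \<le> 1 / l ^ (n - 1)"
proof -
  have "a j * l ^ (n - 1) = a j * (\<Prod>i\<in>{..<n} - {j}. l)" using j by simp
  also have "\<dots> \<le> a j * (\<Prod>i\<in>{..<n} - {j}. a i)"
    using a j l by (intro mult_left_mono prod_mono) (auto simp: unit_measure_cuboids_def less_imp_le)
  also have "\<dots> = 1" using a j by (subst prod.remove[symmetric]) (auto simp: unit_measure_cuboids_def)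
  finally show ?thesis using l by (simp add: field_simps)
qed

text \<open>The sign \<open>s\<close> treats minimum and maximum at once.\<close>

lemma listing_mode_eigenvalue_extremum:
  fixes n k :: nat
  assumes I: "infinite I" "I \<subseteq> {..<n} \<rightarrow>\<^sub>E UNIV" and s: "s = 1 \<or> s = -1" and l: "0 < l"
  defines "e \<equiv> \<lambda>a. s * nondecreasing_listing I (mode_eigenvalue n a) k"
  assumes bound: "\<And>a j. a \<in> unit_measure_cuboids n \<Longrightarrow> e a \<le> e unit_cube \<Longrightarrow> j < n \<Longrightarrow> l \<le> a j"
  shows "\<exists>a\<in>unit_measure_cuboids n. \<forall>b\<in>unit_measure_cuboids n. e a \<le> e b"
proof -
  let ?K = "cuboid_box n l (1 / l ^ (n - 1))"
  \<comment> \<open>The box has to represent only cuboids at least as good as the cube: all others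
    lose to the cube, which is itself represented.\<close>
  have K: "\<exists>b\<in>?K. e b = e a" if a: "a \<in> unit_measure_cuboids n" "e a \<le> e unit_cube" for a
  proof
    let ?b = "\<lambda>j. if j < n then a j else 1"
    show "e ?b = e a" unfolding e_def by (subst mode_eigenvalue_cong[of n ?b a]) auto
    have "?b \<in> unit_measure_cuboids n" using a by (auto simp: unit_measure_cuboids_def)
    thus "?b \<in> ?K" using bound[OF a] unit_cuboid_sides_le[OF a(1) l] 
      by (auto simp: cuboid_box_def)
  qed
  have "?K \<subseteq> {a. \<forall>j<n. 0 < a j}" by (auto simp: cuboid_box_def unit_measure_cuboids_def)
  from continuous_on_subset[OF continuous_on_listing_mode_eigenvalue[OF I] this]
  have "continuous_on ?K e" unfolding e_def by (intro continuous_intros)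
  moreover have "?K \<noteq> {}" using K[OF unit_cube_in] by auto
  ultimately obtain a where a: "a \<in> ?K" "\<forall>b\<in>?K. e a \<le> e b"
    using continuous_attains_inf[OF compact_cuboid_box[OF l]] by blast
  have cube: "e a \<le> e unit_cube" using K[OF unit_cube_in] a by auto
  have "e a \<le> e b" if "b \<in> unit_measure_cuboids n" for b
  proof (cases "e b \<le> e unit_cube")
    case True
    thus ?thesis using K[OF that] a by fastforce
  next
    case False
    thus ?thesis using cube by linarith
  qed
  thus ?thesis using a by (auto simp: cuboid_box_def)
qed

section \<open>Optimal cuboids do not degenerate\<close>

lemma infinite_PiE_lessThan:
  assumes "n \<ge> 1" "infinite X"
  shows "infinite ({..<n::nat} \<rightarrow>\<^sub>E X)"
proof -
  have "inj_on (\<lambda>q. \<lambda>j\<in>{..<n}. q) X"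
    using assms(1) by (auto simp: inj_on_def fun_eq_iff restrict_def dest!: spec[of _ 0] split: if_splits)
  hence "infinite ((\<lambda>q. \<lambda>j\<in>{..<n}. q) ` X)" using assms(2) finite_imageD by blast
  moreover have "(\<lambda>q. \<lambda>j\<in>{..<n}. q) ` X \<subseteq> {..<n} \<rightarrow>\<^sub>E X" by (auto split: if_splits)
  ultimately show ?thesis using infinite_super by blast
qed

lemma sublevel_mode_eigenvalue:
  "sublevel ({..<n} \<rightarrow>\<^sub>E X) (mode_eigenvalue n a) (pi\<^sup>2 * t\<^sup>2) = coord_points real X {..<n} a t"
proof -
  have "mode_eigenvalue n a i = pi\<^sup>2 * (\<Sum>j<n. (real (i j))\<^sup>2 / (a j)\<^sup>2)" for i
    by (simp add: mode_eigenvalue_def sum_distrib_left)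
  thus ?thesis by (auto simp: sublevel_def coord_points_def)
qed

text \<open>In the variable t = sqrt \<lambda> / pi, sublevel sets become lattice points of radius
  t. Positions start at 0, hence the strict \<open>k < card\<close>; Dirichlet indices start at 1,
  which turns it into a weak inequality.\<close>

lemma listing_radius:
  fixes n :: nat
  assumes n: "n \<ge> 1" and X: "infinite X" and a: "\<And>j. j < n \<Longrightarrow> 0 < a j"
  shows "\<exists>s\<ge>0. nondecreasing_listing ({..<n} \<rightarrow>\<^sub>E X) (mode_eigenvalue n a) k = pi\<^sup>2 * s\<^sup>2 \<and>
    (\<forall>t\<ge>0. s \<le> t \<longleftrightarrow> k < card (coord_points real X {..<n} a t))"
proof -
  let ?I = "{..<n} \<rightarrow>\<^sub>E X" and ?f = "mode_eigenvalue n a"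
  define e where "e = nondecreasing_listing ?I ?f k"
  have iff: "e \<le> x \<longleftrightarrow> k < card (sublevel ?I ?f x)" for x
    unfolding e_def
    by (intro nondecreasing_listing_le_iff infinite_PiE_lessThan n X finite_sublevel_mode_eigenvalue a) auto
  have "sublevel ?I ?f e \<noteq> {}" using iff[of e] by auto
  then obtain i where "?f i \<le> e" by (auto simp: sublevel_def)
  moreover have "0 \<le> ?f i" by (auto simp: mode_eigenvalue_def intro!: sum_nonneg)
  ultimately have e: "0 \<le> e" by linarith
  define s where "s = sqrt e / pi"
  have s: "0 \<le> s" "e = pi\<^sup>2 * s\<^sup>2" using e by (auto simp: s_def power_divide)
  have "s \<le> t \<longleftrightarrow> k < card (coord_points real X {..<n} a t)" if "0 \<le> t" for t
  proof -
    have "s \<le> t \<longleftrightarrow> e \<le> pi\<^sup>2 * t\<^sup>2" using s that by simp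
    also have "\<dots> \<longleftrightarrow> k < card (coord_points real X {..<n} a t)"
      unfolding iff sublevel_mode_eigenvalue ..
    finally show ?thesis .
  qed
  thus ?thesis using s unfolding e_def[symmetric] by (intro exI[of _ s]) simp
qed

lemma dirichlet_radius:
  assumes "n \<ge> 1" "k \<ge> 1" "\<And>j. j < n \<Longrightarrow> 0 < a j"
  obtains s where "0 \<le> s" "dirichlet_eigenvalue n k a = pi\<^sup>2 * s\<^sup>2"
    "\<And>t. 0 \<le> t \<Longrightarrow> s \<le> t \<longleftrightarrow> real k \<le> pos_count {..<n} a t"
proof -
  have "infinite {1::nat..}" by (rule infinite_Ici)
  from listing_radius[of n "{1..}" a "k - 1", OF assms(1) this assms(3)] obtain s where
    "0 \<le> s" "dirichlet_eigenvalue n k a = pi\<^sup>2 * s\<^sup>2"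
    and s: "\<forall>t\<ge>0. s \<le> t \<longleftrightarrow> k - 1 < card (coord_points real {1..} {..<n} a t)"
    unfolding dirichlet_eigenvalue_def by blast
  moreover have "s \<le> t \<longleftrightarrow> real k \<le> pos_count {..<n} a t" if "0 \<le> t" for t
    using s that assms(2) by (auto simp: pos_count_def)
  ultimately show ?thesis using that by (metis (no_types, lifting))
qed

lemma neumann_radius:
  assumes "n \<ge> 1" "\<And>j. j < n \<Longrightarrow> 0 < a j"
  obtains s where "0 \<le> s" "neumann_eigenvalue n k a = pi\<^sup>2 * s\<^sup>2"
    "\<And>t. 0 \<le> t \<Longrightarrow> s \<le> t \<longleftrightarrow> real k < nonneg_count {..<n} a t"
proof -
  from listing_radius[of n UNIV a k, OF assms(1) infinite_UNIV_nat assms(2)] obtain s where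
    "0 \<le> s" "neumann_eigenvalue n k a = pi\<^sup>2 * s\<^sup>2"
    and s: "\<forall>t\<ge>0. s \<le> t \<longleftrightarrow> k < card (coord_points real UNIV {..<n} a t)"
    unfolding neumann_eigenvalue_def by blast
  moreover have "s \<le> t \<longleftrightarrow> real k < nonneg_count {..<n} a t" if "0 \<le> t" for t
    using s that by (auto simp: nonneg_count_def)
  ultimately show ?thesis using that by (metis (no_types, lifting))
qed

definition orthant_const :: "nat \<Rightarrow> real" where
  "orthant_const m = unit_ball_vol (real m) / 2 ^ m"

lemma orthant_const_pos: "orthant_const m > 0"
  by (simp add: orthant_const_def)

lemma orthant_volume_unit:
  assumes "a \<in> unit_measure_cuboids n"
  shows "orthant_volume {..<n} a t = orthant_const n * t ^ n"
  using assms by (simp add: orthant_volume_def orthant_const_def unit_measure_cuboids_def)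

lemma orthant_volume_unit_face:
  assumes "a \<in> unit_measure_cuboids n" "j < n"
  shows "orthant_volume ({..<n} - {j}) a t = orthant_const (n - 1) * t ^ (n - 1) / a j"
proof -
  have "a j * prod a ({..<n} - {j}) = 1" "a j \<noteq> 0"
    using assms prod.remove[of "{..<n}" j a] by (auto simp: unit_measure_cuboids_def)
  hence "prod a ({..<n} - {j}) = 1 / a j" by (simp add: field_simps)
  moreover have "card ({..<n} - {j}) = n - 1" using assms by simp
  ultimately show ?thesis by (simp add: orthant_volume_def orthant_const_def)
qed

text \<open>A counting function jumps at an eigenvalue by its multiplicity, so at the radius itself
  the count may exceed k. Strictly below it the count is at most k, and a continuous lower bound for
  the count inherits this at the radius.\<close>

lemma le_at_left_limit:
  fixes P :: "real \<Rightarrow> real"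
  assumes "s0 < s" "\<And>t. s0 \<le> t \<Longrightarrow> t < s \<Longrightarrow> P t \<le> c" "isCont P s"
  shows "P s \<le> c"
proof (rule tendsto_upperbound)
  show "(P \<longlongrightarrow> P s) (at_left s)" using assms(3) by (simp add: isCont_def filterlim_at_split)
  show "\<forall>\<^sub>F t in at_left s. P t \<le> c"
    using eventually_at_left_real[OF assms(1)] by eventually_elim (use assms(2) in auto)
qed simp

lemma pos_count_eq_0:
  assumes "finite S" "j \<in> S" "\<And>i. i \<in> S \<Longrightarrow> 0 < a i" "0 \<le> t" "a j * t < 1"
  shows "pos_count S a t = 0"
proof -
  have "{q. 1 \<le> q \<and> real q \<le> a j * t} = {}"
  proof (rule ccontr)
    assume "{q. 1 \<le> q \<and> real q \<le> a j * t} \<noteq> {}"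
    then obtain q :: nat where "1 \<le> q" "real q \<le> a j * t" by blast
    moreover from this have "1 \<le> real q" by simp
    ultimately show False using assms by linarith
  qed
  moreover have "pos_count (insert j (S - {j})) a t =
      (\<Sum>q | 1 \<le> q \<and> real q \<le> a j * t. pos_count (S - {j}) a (slice_radius (a j) t (real q)))"
    using assms by (intro pos_count_insert) auto
  ultimately show ?thesis using assms(2) by (simp only: insert_Diff sum.empty)
qed

text \<open>In units of \<open>orthant_const (n - 1) * s ^ (n - 1)\<close> the cuboid loses at least
  \<open>sum_defect (n - 1) / a j\<close>, the cube at most 1 for each of its n coordinate faces.
  This holds for every k >= 1, as attainment of each minimum requires.\<close>

lemma dirichlet_sides_bound:
  assumes n: "n \<ge> 2" and k: "k \<ge> 1" and a: "a \<in> unit_measure_cuboids n"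
    and le: "dirichlet_eigenvalue n k a \<le> dirichlet_eigenvalue n k unit_cube" and j: "j < n"
  shows "sum_defect (n - 1) / real n \<le> a j"
proof -
  let ?S = "{..<n} - {j}" and ?v = "orthant_const n" and ?w = "orthant_const (n - 1)"
  have pos: "0 < a i" if "i < n" for i using a that by (simp add: unit_measure_cuboids_def)
  have S: "finite ?S" "card ?S = n - 1" "?S \<noteq> {}" "insert j ?S = {..<n}"
  proof -
    show "card ?S = n - 1" using j by simp
    hence "card ?S \<noteq> 0" using n by simp
    thus "?S \<noteq> {}" by (metis card.empty)
  qed (use j in auto)
  obtain s where s: "0 \<le> s" "dirichlet_eigenvalue n k a = pi\<^sup>2 * s\<^sup>2"
    "\<And>t. 0 \<le> t \<Longrightarrow> s \<le> t \<longleftrightarrow> real k \<le> pos_count {..<n} a t"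
    using dirichlet_radius[of n k a] n k pos by auto
  obtain u where u: "0 \<le> u" "dirichlet_eigenvalue n k unit_cube = pi\<^sup>2 * u\<^sup>2"
    "\<And>t. 0 \<le> t \<Longrightarrow> u \<le> t \<longleftrightarrow> real k \<le> pos_count {..<n} unit_cube t"
    using dirichlet_radius[of n k unit_cube] n k by (auto simp: unit_cube_def)
  have su: "s \<le> u" using le s(1,2) u(1,2) by (simp add: power2_le_iff_abs_le)
  have ks: "real k \<le> pos_count {..<n} a s" using s(3)[OF s(1)] by simp
  \<comment> \<open>Some point with positive coordinates is counted at s because
    \<open>k >= 1\<close>; this supplies the condition \<open>1 <= a j * s\<close> of the surface
    gain.\<close>
  have as: "1 \<le> a j * s"
  proof (rule ccontr)
    assume "\<not> 1 \<le> a j * s"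
    hence "pos_count {..<n} a s = 0" using pos s(1) j by (intro pos_count_eq_0[of _ j]) auto
    thus False using ks k by simp
  qed
  hence s0: "0 < s" using s(1) by (cases "s = 0") auto
  \<comment> \<open>Below s <= u the cube has not reached k, whereas the cuboid has reached it at
    s.\<close>
  have "?v * t ^ n - real n * ?w * t ^ (n - 1) \<le> real k" if t: "0 \<le> t" "t < s" for t
  proof -
    have "?v * t ^ n - real n * ?w * t ^ (n - 1) =
      orthant_volume {..<n} unit_cube t - (\<Sum>i<n. orthant_volume ({..<n} - {i}) unit_cube t)"
      using orthant_volume_unit[OF unit_cube_in] orthant_volume_unit_face[OF unit_cube_in]
      by (simp add: unit_cube_def)
    also have "\<dots> \<le> pos_count {..<n} unit_cube t"
      using t by (intro pos_count_ge_volume) (auto simp: unit_cube_def)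
    also have "\<dots> \<le> real k" using u(3)[of t] t su by simp
    finally show ?thesis .
  qed
  hence "?v * s ^ n - real n * ?w * s ^ (n - 1) \<le> real k"
    by (rule le_at_left_limit[OF s0]) (auto intro!: continuous_intros)
  also note ks
  also have "pos_count {..<n} a s \<le> ?v * s ^ n - sum_defect (n - 1) * (?w * s ^ (n - 1) / a j)"
  proof -
    have "pos_count (insert j ?S) a s + sum_defect (card ?S) * orthant_volume ?S a s \<le> orthant_volume (insert j ?S) a s"
      using S(1,3) pos j as s0 by (intro pos_count_insert_le_volume_defect) auto
    thus ?thesis
      unfolding S(2,4) orthant_volume_unit[OF a] orthant_volume_unit_face[OF a j] by simp
  qed
  finally have "(?w * s ^ (n - 1)) * (sum_defect (n - 1) / a j) \<le> (?w * s ^ (n - 1)) * real n"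
    by (simp add: algebra_simps)
  moreover have "0 < ?w * s ^ (n - 1)" using s0 orthant_const_pos by simp
  ultimately have "sum_defect (n - 1) / a j \<le> real n" by (simp only: mult_le_cancel_left_pos)
  thus ?thesis using pos[OF j] n by (simp add: field_simps)
qed

text \<open>The cube's Neumann count carries all lower-dimensional faces; for t >= 1 they are
  absorbed into \<open>C\<close> t^(n-1), with \<open>C\<close> the sum of their constants. For
  \<open>k = 0\<close> the eigenvalue is 0 on every cuboid and no bound could follow.\<close>

lemma neumann_sides_bound:
  assumes n: "n \<ge> 2"
  shows "\<exists>l>0. \<forall>k\<ge>1. \<forall>a\<in>unit_measure_cuboids n.
    neumann_eigenvalue n k unit_cube \<le> neumann_eigenvalue n k a \<longrightarrow> (\<forall>j<n. l \<le> a j)"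
proof -
  let ?v = "orthant_const n" and ?w = "orthant_const (n - 1)"
  define C where "C = (\<Sum>T\<in>Pow {..<n} - {{..<n}}. orthant_const (card T))"
  define l where "l = sum_defect (n - 1) * ?w / C"
  have C: "C > 0" unfolding C_def
    by (rule sum_pos) (use n orthant_const_pos in auto)
  have upper: "nonneg_count {..<n} unit_cube t \<le> ?v * t ^ n + C * t ^ (n - 1)" if t: "1 \<le> t" for t
  proof -
    have V: "orthant_volume T unit_cube t = orthant_const (card T) * t ^ card T" for T
      by (simp add: orthant_volume_def orthant_const_def unit_cube_def)
    have "nonneg_count {..<n} unit_cube t = (\<Sum>T\<in>Pow {..<n}. pos_count T unit_cube t)"
      using t by (intro nonneg_count_eq) (auto simp: unit_cube_def)
    also have "\<dots> \<le> (\<Sum>T\<in>Pow {..<n}. orthant_volume T unit_cube t)"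
      using t by (intro sum_mono pos_count_le_volume) (auto simp: unit_cube_def intro: finite_subset)
    also have "\<dots> = ?v * t ^ n + (\<Sum>T\<in>Pow {..<n} - {{..<n}}. orthant_const (card T) * t ^ card T)"
      by (subst sum.remove[of _ "{..<n}"]) (auto simp: V)
    also have "(\<Sum>T\<in>Pow {..<n} - {{..<n}}. orthant_const (card T) * t ^ card T) \<le>
        (\<Sum>T\<in>Pow {..<n} - {{..<n}}. orthant_const (card T) * t ^ (n - 1))"
    proof (intro sum_mono mult_left_mono power_increasing t)
      fix T assume "T \<in> Pow {..<n} - {{..<n}}"
      hence "T \<subset> {..<n}" by auto
      from psubset_card_mono[OF _ this] show "card T \<le> n - 1" by simp
    qed (use orthant_const_pos in \<open>auto intro: less_imp_le\<close>)
    finally show ?thesis by (simp add: C_def sum_distrib_right)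
  qed
  have "l \<le> a j" if k: "k \<ge> 1" and a: "a \<in> unit_measure_cuboids n"
    and le: "neumann_eigenvalue n k unit_cube \<le> neumann_eigenvalue n k a" and j: "j < n" for k a j
  proof -
    let ?S = "{..<n} - {j}"
    have pos: "0 < a i" if "i < n" for i using a that by (simp add: unit_measure_cuboids_def)
    have S: "finite ?S" "card ?S = n - 1" "?S \<noteq> {}" "insert j ?S = {..<n}"
    proof -
      show "card ?S = n - 1" using j by simp
      hence "card ?S \<noteq> 0" using n by simp
    thus "?S \<noteq> {}" by (metis card.empty)
    qed (use j in auto)
    obtain s where s: "0 \<le> s" "neumann_eigenvalue n k a = pi\<^sup>2 * s\<^sup>2"
      "\<And>t. 0 \<le> t \<Longrightarrow> s \<le> t \<longleftrightarrow> real k < nonneg_count {..<n} a t"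
      using neumann_radius[of n a k] n pos by auto
    obtain u where u: "0 \<le> u" "neumann_eigenvalue n k unit_cube = pi\<^sup>2 * u\<^sup>2"
      "\<And>t. 0 \<le> t \<Longrightarrow> u \<le> t \<longleftrightarrow> real k < nonneg_count {..<n} unit_cube t"
      using neumann_radius[of n unit_cube k] n by (auto simp: unit_cube_def)
    have us: "u \<le> s" using le s(1,2) u(1,2) by (simp add: power2_le_iff_abs_le)
    \<comment> \<open>Below radius 1 only the origin is counted, and one point does not exceed
      \<open>k >= 1\<close>.\<close>
    have "1 \<le> u"
    proof (rule ccontr)
      assume "\<not> 1 \<le> u"
      hence "pos_count T unit_cube u = 0" if "T \<in> Pow {..<n} - {{}}" for T
      proof -
        have "T \<noteq> {}" using that by simp
        then obtain i where "i \<in> T" by blast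
        thus ?thesis using \<open>\<not> 1 \<le> u\<close> u(1) that
          by (intro pos_count_eq_0[of T i]) (auto simp: unit_cube_def intro: finite_subset)
      qed
      moreover have "nonneg_count {..<n} unit_cube u = (\<Sum>T\<in>Pow {..<n}. pos_count T unit_cube u)"
        using u(1) by (intro nonneg_count_eq) (auto simp: unit_cube_def)
      ultimately have "nonneg_count {..<n} unit_cube u = 1"
        by (subst (asm) sum.remove[of _ "{}"]) auto
      thus False using u(3)[OF u(1)] k by simp
    qed
    hence s1: "1 \<le> s" using us by simp
    \<comment> \<open>Starting at s / 2 keeps t positive, as the surface gain requires.\<close>
    have "?v * t ^ n + sum_defect (n - 1) * (?w * t ^ (n - 1) / a j) \<le> real k" if t: "s / 2 \<le> t" "t < s" for t
    proof -
      have "?v * t ^ n + sum_defect (n - 1) * (?w * t ^ (n - 1) / a j) \<le> nonneg_count {..<n} a t"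
      proof -
        have "orthant_volume (insert j ?S) a t + sum_defect (card ?S) * orthant_volume ?S a t \<le> nonneg_count (insert j ?S) a t"
          using S(1,3) pos j s1 t by (intro nonneg_count_insert_ge_volume_defect) auto
        thus ?thesis
          unfolding S(2,4) orthant_volume_unit[OF a] orthant_volume_unit_face[OF a j] by simp
      qed
      also have "\<dots> \<le> real k" using s(3)[of t] t s1 by simp
      finally show ?thesis .
    qed
    hence "?v * s ^ n + sum_defect (n - 1) * (?w * s ^ (n - 1) / a j) \<le> real k"
      by (rule le_at_left_limit[of "s / 2", rotated]) (use s1 pos[OF j] in \<open>auto intro!: continuous_intros\<close>)
    also have "real k \<le> nonneg_count {..<n} unit_cube s" using u(3)[of s] us s1 by simp
    also have "\<dots> \<le> ?v * s ^ n + C * s ^ (n - 1)" by (rule upper[OF s1])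
    finally have "s ^ (n - 1) * (sum_defect (n - 1) * ?w / a j) \<le> s ^ (n - 1) * C"
      by (simp add: algebra_simps)
    moreover have "0 < s ^ (n - 1)" using s1 by simp
    ultimately have "sum_defect (n - 1) * ?w / a j \<le> C" by (simp only: mult_le_cancel_left_pos)
    thus ?thesis using C pos[OF j] by (simp add: l_def field_simps)
  qed
  moreover have "l > 0" using C sum_defect_pos orthant_const_pos by (simp add: l_def)
  ultimately show ?thesis by blast
qed

text \<open>\<open>LEAST\<close> over the reals is informative only if a minimiser exists; the lower
  bound on the sides of competitors yields the compact set that contains one.\<close>

lemma min_dirichlet_attained:
  assumes "n \<ge> 2" "k \<ge> 1"
  shows "\<exists>a\<in>unit_measure_cuboids n. min_dirichlet_eigenvalue n k = dirichlet_eigenvalue n k a \<and>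
    (\<forall>b\<in>unit_measure_cuboids n. dirichlet_eigenvalue n k a \<le> dirichlet_eigenvalue n k b)"
proof -
  have "\<exists>a\<in>unit_measure_cuboids n. \<forall>b\<in>unit_measure_cuboids n.
      1 * nondecreasing_listing ({..<n} \<rightarrow>\<^sub>E {1..}) (mode_eigenvalue n a) (k - 1) \<le>
      1 * nondecreasing_listing ({..<n} \<rightarrow>\<^sub>E {1..}) (mode_eigenvalue n b) (k - 1)"
  proof (rule listing_mode_eigenvalue_extremum[where l = "sum_defect (n - 1) / real n"])
    show "infinite ({..<n} \<rightarrow>\<^sub>E {1::nat..})" using assms by (intro infinite_PiE_lessThan infinite_Ici) auto
    show "0 < sum_defect (n - 1) / real n" using assms sum_defect_pos by simp
    show "sum_defect (n - 1) / real n \<le> a j" if "a \<in> unit_measure_cuboids n" "j < n"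
      "1 * nondecreasing_listing ({..<n} \<rightarrow>\<^sub>E {1..}) (mode_eigenvalue n a) (k - 1) \<le>
       1 * nondecreasing_listing ({..<n} \<rightarrow>\<^sub>E {1..}) (mode_eigenvalue n unit_cube) (k - 1)" for a j
      using that assms by (intro dirichlet_sides_bound) (auto simp: dirichlet_eigenvalue_def)
  qed auto
  then obtain a where a: "a \<in> unit_measure_cuboids n"
    "\<forall>b\<in>unit_measure_cuboids n. dirichlet_eigenvalue n k a \<le> dirichlet_eigenvalue n k b"
    by (auto simp: dirichlet_eigenvalue_def)
  have "min_dirichlet_eigenvalue n k = dirichlet_eigenvalue n k a"
    unfolding min_dirichlet_eigenvalue_def by (rule Least_equality) (use a in auto)
  thus ?thesis using a by blast
qed

lemma max_neumann_attained:
  assumes "n \<ge> 2" "k \<ge> 1"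
  shows "\<exists>a\<in>unit_measure_cuboids n. max_neumann_eigenvalue n k = neumann_eigenvalue n k a \<and>
    (\<forall>b\<in>unit_measure_cuboids n. neumann_eigenvalue n k b \<le> neumann_eigenvalue n k a)"
proof -
  obtain l where l: "l > 0" "\<And>k a j. k \<ge> 1 \<Longrightarrow> a \<in> unit_measure_cuboids n \<Longrightarrow>
    neumann_eigenvalue n k unit_cube \<le> neumann_eigenvalue n k a \<Longrightarrow> j < n \<Longrightarrow> l \<le> a j"
    using neumann_sides_bound[OF assms(1)] by blast
  have "\<exists>a\<in>unit_measure_cuboids n. \<forall>b\<in>unit_measure_cuboids n.
      -1 * nondecreasing_listing ({..<n} \<rightarrow>\<^sub>E UNIV) (mode_eigenvalue n a) k \<le>
      -1 * nondecreasing_listing ({..<n} \<rightarrow>\<^sub>E UNIV) (mode_eigenvalue n b) k"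
  proof (rule listing_mode_eigenvalue_extremum[where l = l])
    show "infinite ({..<n} \<rightarrow>\<^sub>E (UNIV :: nat set))" using assms by (intro infinite_PiE_lessThan) auto
    show "l \<le> a j" if "a \<in> unit_measure_cuboids n" "j < n"
      "-1 * nondecreasing_listing ({..<n} \<rightarrow>\<^sub>E UNIV) (mode_eigenvalue n a) k \<le>
       -1 * nondecreasing_listing ({..<n} \<rightarrow>\<^sub>E UNIV) (mode_eigenvalue n unit_cube) k" for a j
      using that assms by (intro l(2)[of k]) (auto simp: neumann_eigenvalue_def)
  qed (use l in auto)
  then obtain a where a: "a \<in> unit_measure_cuboids n"
    "\<forall>b\<in>unit_measure_cuboids n. neumann_eigenvalue n k b \<le> neumann_eigenvalue n k a"
    by (auto simp: neumann_eigenvalue_def)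
  have "max_neumann_eigenvalue n k = neumann_eigenvalue n k a"
    unfolding max_neumann_eigenvalue_def by (rule Greatest_equality) (use a in auto)
  thus ?thesis using a by blast
qed

section \<open>Two-term asymptotics\<close>

text \<open>\<open>B\<close> depends on \<open>n\<close> and \<open>u\<close> only, which makes the
  estimate uniform in the sides. The slack \<open>card T \<le> m\<close> lets all faces of
  codimension at least 2 share the power t^(n-2).\<close>

lemma orthant_volume_le:
  assumes "0 < u"
  shows "\<exists>B\<ge>0. \<forall>T a t m. T \<subseteq> {..<n} \<longrightarrow> (\<forall>j<n. 0 < a j \<and> a j \<le> u) \<longrightarrow> 1 \<le> t \<longrightarrow> card T \<le> m \<longrightarrow>
    orthant_volume T a t \<le> B * t ^ m"
proof -
  define B where "B = (\<Sum>T\<in>Pow {..<n}. orthant_const (card T) * u ^ card T)"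
  have nn: "0 \<le> orthant_const m * u ^ m" for m
    using orthant_const_pos[of m] assms by simp
  have "orthant_volume T a t \<le> B * t ^ m"
    if T: "T \<subseteq> {..<n}" and a: "\<forall>j<n. 0 < a j \<and> a j \<le> u" and t: "1 \<le> t" and m: "card T \<le> m" for T a t m
  proof -
    have "prod a T \<le> (\<Prod>j\<in>T. u)"
      using T a by (intro prod_mono) (auto simp: less_imp_le)
    hence "orthant_volume T a t \<le> orthant_const (card T) * t ^ card T * u ^ card T"
      unfolding orthant_volume_def orthant_const_def using t by (intro mult_left_mono) auto
    also have "\<dots> = (orthant_const (card T) * u ^ card T) * t ^ card T" by simp
    also have "\<dots> \<le> (orthant_const (card T) * u ^ card T) * t ^ m"
      using t m nn by (intro mult_left_mono power_increasing) auto
    also have "\<dots> \<le> B * t ^ m"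
    proof (intro mult_right_mono)
      show "orthant_const (card T) * u ^ card T \<le> B" unfolding B_def
        by (rule member_le_sum[where f = "\<lambda>T. orthant_const (card T) * u ^ card T"]) (use T nn in auto)
    qed (use t in auto)
    finally show ?thesis .
  qed
  moreover have "B \<ge> 0" unfolding B_def by (intro sum_nonneg nn)
  ultimately show ?thesis by blast
qed

lemma pos_count_nonneg: "0 \<le> pos_count S a t"
  by (simp add: pos_count_def)

lemma ellipsoid_lattice_points_count:
  "real (card (ellipsoid_lattice_points n a t)) = int_count {..<n} a t"
  by (simp add: ellipsoid_lattice_points_def int_count_def coord_points_def)

lemma int_count_unit_cube_const:
  assumes "0 \<le> s" "s \<le> t" "real m \<le> s\<^sup>2" "t\<^sup>2 < real m + 1"
  shows "int_count {..<n} unit_cube s = int_count {..<n} unit_cube t"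
proof -
  have "(\<Sum>j<n. (real_of_int (z j))\<^sup>2 / (unit_cube j)\<^sup>2) \<le> s\<^sup>2 \<longleftrightarrow> (\<Sum>j<n. (real_of_int (z j))\<^sup>2 / (unit_cube j)\<^sup>2) \<le> t\<^sup>2" for z
  proof -
    have eq: "(\<Sum>j<n. (real_of_int (z j))\<^sup>2 / (unit_cube j)\<^sup>2) = real_of_int (\<Sum>j<n. (z j)\<^sup>2)"
      by (simp add: unit_cube_def)
    show ?thesis unfolding eq
    proof
      assume "real_of_int (\<Sum>j<n. (z j)\<^sup>2) \<le> s\<^sup>2"
      also have "s\<^sup>2 \<le> t\<^sup>2" using assms by (intro power_mono) auto
      finally show "real_of_int (\<Sum>j<n. (z j)\<^sup>2) \<le> t\<^sup>2" .
    next
      assume "real_of_int (\<Sum>j<n. (z j)\<^sup>2) \<le> t\<^sup>2"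
      also note \<open>t\<^sup>2 < real m + 1\<close>
      finally have "(\<Sum>j<n. (z j)\<^sup>2) \<le> int m" by linarith
      hence "real_of_int (\<Sum>j<n. (z j)\<^sup>2) \<le> real m" by linarith
      thus "real_of_int (\<Sum>j<n. (z j)\<^sup>2) \<le> s\<^sup>2" using assms by linarith
    qed
  qed
  hence "coord_points real_of_int UNIV {..<n} unit_cube s = coord_points real_of_int UNIV {..<n} unit_cube t"
    unfolding coord_points_def by simp
  thus ?thesis by (simp add: int_count_def)
qed

lemma power_diff_ge:
  fixes x y :: real
  assumes "0 \<le> x" "x \<le> y" "1 \<le> n"
  shows "y ^ (n - 1) * (y - x) \<le> y ^ n - x ^ n"
proof -
  obtain p where n: "n = Suc p" using assms(3) by (cases n) auto
  have "x ^ p * x \<le> y ^ p * x" using assms by (intro mult_right_mono power_mono) auto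
  thus ?thesis by (simp add: n algebra_simps)
qed

lemma power_diff_le:
  fixes x y :: real
  assumes "0 \<le> x" "x \<le> y"
  shows "y ^ n - x ^ n \<le> real n * y ^ (n - 1) * (y - x)"
proof (induction n)
  case (Suc n)
  have "y ^ Suc n - x ^ Suc n = y * (y ^ n - x ^ n) + x ^ n * (y - x)" by (simp add: algebra_simps)
  also have "\<dots> \<le> y * (real n * y ^ (n - 1) * (y - x)) + y ^ n * (y - x)"
    using Suc assms by (intro add_mono mult_left_mono mult_right_mono power_mono) auto
  also have "\<dots> = real (Suc n) * y ^ (Suc n - 1) * (y - x)"
    by (cases n) (auto simp: algebra_simps)
  finally show ?case .
qed simp

text \<open>Between s = sqrt m and t = sqrt (m + 1/2) the cube's count stays fixed while the volume
  grows by at least \<omega> s^(n-2) / 4, so the two lattice errors together are at least that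
  large.\<close>

lemma admissible_exponent_ge:
  assumes "n \<ge> 2" and adm: "admissible_exponent n \<theta>"
  shows "real n - 2 \<le> \<theta>"
proof (rule ccontr)
  assume "\<not> real n - 2 \<le> \<theta>"
  hence less: "\<theta> - (real n - 2) < 0" by simp
  define \<omega> where "\<omega> = unit_ball_vol (real n)"
  have \<omega>: "\<omega> > 0" by (simp add: \<omega>_def)
  have "compact {1::real} \<and> {1::real} \<subseteq> {0<..}" by auto
  with adm obtain C where C: "\<forall>\<^sub>F t in at_top. \<forall>a. (\<forall>j<n. a j \<in> {1}) \<longrightarrow>
       \<bar>real (card (ellipsoid_lattice_points n a t)) - unit_ball_vol (real n) * t ^ n * (\<Prod>j<n. a j)\<bar> \<le> C * t powr \<theta>"
    unfolding admissible_exponent_def by meson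
  have "\<forall>\<^sub>F t in at_top. \<bar>int_count {..<n} unit_cube t - \<omega> * t ^ n\<bar> \<le> C * t powr \<theta>"
    using C by eventually_elim (auto simp: ellipsoid_lattice_points_count \<omega>_def unit_cube_def dest!: spec[of _ unit_cube])
  then obtain T0 where T0: "\<And>t. T0 \<le> t \<Longrightarrow> \<bar>int_count {..<n} unit_cube t - \<omega> * t ^ n\<bar> \<le> C * t powr \<theta>"
    unfolding eventually_at_top_linorder by auto
  \<comment> \<open>The error at t is compared with the radius s: t / s lies between 1 and 2, and
    the absolute value of \<theta> covers both signs. \<open>C\<close> comes without a sign as
    well.\<close>
  define D where "D = \<bar>C\<bar> * (1 + 2 powr \<bar>\<theta>\<bar>)"
  have D: "\<omega> / 4 \<le> D * sqrt (real m) powr (\<theta> - (real n - 2))" if m: "1 \<le> m" "max T0 1 \<le> sqrt (real m)" for m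
  proof -
    define s t where "s = sqrt (real m)" and "t = sqrt (real m + 1 / 2)"
    have st: "1 \<le> s" "s \<le> t" "T0 \<le> s" "s\<^sup>2 = real m" "t\<^sup>2 = real m + 1/2"
      using m by (auto simp: s_def t_def)
    have t2: "t \<le> 2 * s" 
    proof (rule power2_le_imp_le)
      show "t\<^sup>2 \<le> (2 * s)\<^sup>2" using st m by (simp add: power_mult_distrib)
    qed (use st in auto)
    have eq: "int_count {..<n} unit_cube s = int_count {..<n} unit_cube t"
      using st by (intro int_count_unit_cube_const[of _ _ m]) auto
    have "\<omega> * t ^ n - \<omega> * s ^ n \<le> C * s powr \<theta> + C * t powr \<theta>"
      using T0[of s] T0[of t] st eq by auto
    also have "\<dots> \<le> \<bar>C\<bar> * s powr \<theta> + \<bar>C\<bar> * t powr \<theta>" by (intro add_mono mult_right_mono) auto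
    also have "t powr \<theta> \<le> s powr \<theta> * 2 powr \<bar>\<theta>\<bar>"
    proof -
      have "(t / s) powr \<theta> \<le> (t / s) powr \<bar>\<theta>\<bar>" using st by (intro powr_mono) (auto simp: field_simps)
      also have "\<dots> \<le> 2 powr \<bar>\<theta>\<bar>" using st t2 by (intro powr_mono2) (auto simp: field_simps)
      finally show ?thesis using st by (simp add: powr_divide field_simps)
    qed
    hence "\<bar>C\<bar> * s powr \<theta> + \<bar>C\<bar> * t powr \<theta> \<le> D * s powr \<theta>"
      by (simp add: D_def algebra_simps mult_left_mono)
    finally have 1: "\<omega> * (t ^ n - s ^ n) \<le> D * s powr \<theta>" by (simp add: algebra_simps)
    have "s ^ (n - 2) / 4 \<le> t ^ (n - 1) * (t - s)"
    proof -
      have "(t - s) * (t + s) = 1 / 2" using st by (simp add: algebra_simps power2_eq_square)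
      hence "1 / 2 \<le> (t - s) * (2 * t)" using st mult_left_mono[of "t + s" "2 * t" "t - s"] by simp
      hence "1 / 4 \<le> t * (t - s)" by (simp add: mult.commute)
      hence "s ^ (n - 2) * (1 / 4) \<le> t ^ (n - 2) * (t * (t - s))"
        using st by (intro mult_mono power_mono) auto
      also have "\<dots> = t ^ (n - 1) * (t - s)"
      proof -
        have "n - 1 = Suc (n - 2)" using assms(1) by simp
        thus ?thesis by simp
      qed
      finally show ?thesis by simp
    qed
    also have "\<dots> \<le> t ^ n - s ^ n" using st assms(1) by (intro power_diff_ge) auto
    finally have "\<omega> * (s ^ (n - 2) / 4) \<le> \<omega> * (t ^ n - s ^ n)" using \<omega> by (intro mult_left_mono) auto
    with 1 have "\<omega> / 4 * s ^ (n - 2) \<le> D * s powr \<theta>" by simp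
    also have "s ^ (n - 2) = s powr (real n - 2)"
      using st assms(1) powr_realpow[of s "n - 2"] by (simp add: of_nat_diff)
    finally have "\<omega> / 4 \<le> D * s powr \<theta> / s powr (real n - 2)"
      using st by (subst pos_le_divide_eq) auto
    thus ?thesis using st unfolding powr_diff s_def[symmetric] by simp
  qed
  have top: "filterlim (\<lambda>m. sqrt (real m)) at_top sequentially"
    by (intro filterlim_compose[OF sqrt_at_top] filterlim_real_sequentially)
  have "((\<lambda>m. D * sqrt (real m) powr (\<theta> - (real n - 2))) \<longlongrightarrow> D * 0) sequentially"
    by (intro tendsto_intros tendsto_neg_powr less top)
  moreover have "\<forall>\<^sub>F m in sequentially. \<omega> / 4 \<le> D * sqrt (real m) powr (\<theta> - (real n - 2))"
    using eventually_ge_at_top[of 1] top[unfolded filterlim_at_top, rule_format, of "max T0 1"]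
    by eventually_elim (rule D)
  ultimately have "\<omega> / 4 \<le> D * 0" by (intro tendsto_lowerbound) auto
  thus False using \<omega> by simp
qed

lemma sum_Pow_by_codimension:
  fixes g :: "'a set \<Rightarrow> real"
  assumes "finite A" "A \<noteq> {}"
  shows "(\<Sum>T\<in>Pow A. g T) = g A + (\<Sum>j\<in>A. g (A - {j})) + (\<Sum>T | T \<subseteq> A \<and> card T + 2 \<le> card A. g T)"
proof -
  let ?L = "{T. T \<subseteq> A \<and> card T + 2 \<le> card A}" and ?F = "(\<lambda>j. A - {j}) ` A"
  have finL: "finite ?L" by (rule finite_subset[of _ "Pow A"]) (use assms in auto)
  have cF: "card T + 1 = card A" if T: "T \<in> ?F" for T
  proof -
    obtain j where "j \<in> A" "T = A - {j}" using T by auto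
    thus ?thesis using assms by (simp add: card_gt_0_iff Suc_diff_le Suc_leI)
  qed
  have "Pow A = insert A (?F \<union> ?L)"
  proof (intro equalityI subsetI)
    fix T assume T: "T \<in> Pow A"
    hence le: "card T \<le> card A" using assms by (auto intro: card_mono)
    consider "card T = card A" | "card T + 1 = card A" | "card T + 2 \<le> card A" using le by linarith
    thus "T \<in> insert A (?F \<union> ?L)"
    proof cases
      case 1
      thus ?thesis using T assms card_subset_eq by blast
    next
      case 2
      have "card (A - T) = 1" using T 2 assms by (simp add: card_Diff_subset finite_subset)
      then obtain j where "A - T = {j}" using card_1_singletonE by blast
      hence "j \<in> A" "T = A - {j}" using T by auto
      thus ?thesis by blast
    qed (use T in auto)
  qed auto
  moreover have "A \<notin> ?F \<union> ?L" by auto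
  moreover have "?F \<inter> ?L = {}" using cF by fastforce
  moreover have "inj_on (\<lambda>j. A - {j}) A" by (auto simp: inj_on_def)
  ultimately show ?thesis using assms finL by (simp add: sum.union_disjoint sum.reindex)
qed

text \<open>Let P be the positive count, Z its sum over the facets, V and W the corresponding
  volumes. Up to lower faces the integer count is 2^n P + 2^(n-1) Z, so P = V - Z/2 + O(t^\<theta>),
  while the Neumann count is P + Z. Since Z = W + O(t^(n-2)), the term W/2 appears with opposite
  signs.\<close>

lemma count_asymptotics:
  fixes n :: nat and \<theta> l u :: real
  assumes n: "n \<ge> 2" and adm: "admissible_exponent n \<theta>" and l: "0 < l"
  shows "\<exists>C\<ge>0. \<exists>t0\<ge>1. \<forall>t\<ge>t0. \<forall>a. (\<forall>j<n. l \<le> a j \<and> a j \<le> u) \<longrightarrow>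
    \<bar>pos_count {..<n} a t - (orthant_volume {..<n} a t - (\<Sum>j<n. orthant_volume ({..<n} - {j}) a t) / 2)\<bar> \<le> C * t powr \<theta> \<and>
    \<bar>nonneg_count {..<n} a t - (orthant_volume {..<n} a t + (\<Sum>j<n. orthant_volume ({..<n} - {j}) a t) / 2)\<bar> \<le> C * t powr \<theta>"
proof -
  define U where "U = max 1 u"
  obtain B where B: "B \<ge> 0" "\<And>T a t m. T \<subseteq> {..<n} \<Longrightarrow> (\<forall>j<n. 0 < a j \<and> a j \<le> U) \<Longrightarrow> 1 \<le> t \<Longrightarrow> card T \<le> m \<Longrightarrow>
    orthant_volume T a t \<le> B * t ^ m"
    using orthant_volume_le[of U n] unfolding U_def by (metis less_max_iff_disj zero_less_one)
  have "compact {l..u} \<and> {l..u} \<subseteq> {0<..}" using l by auto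
  with adm obtain C0 where C0: "\<forall>\<^sub>F t in at_top. \<forall>a. (\<forall>j<n. a j \<in> {l..u}) \<longrightarrow>
       \<bar>real (card (ellipsoid_lattice_points n a t)) - unit_ball_vol (real n) * t ^ n * (\<Prod>j<n. a j)\<bar> \<le> C0 * t powr \<theta>"
    unfolding admissible_exponent_def by meson
  then obtain T0 where T0: "\<And>t a. T0 \<le> t \<Longrightarrow> \<forall>j<n. a j \<in> {l..u} \<Longrightarrow> 
     \<bar>int_count {..<n} a t - unit_ball_vol (real n) * t ^ n * (\<Prod>j<n. a j)\<bar> \<le> C0 * t powr \<theta>"
    unfolding eventually_at_top_linorder ellipsoid_lattice_points_count by auto
  define A where "A = {..<n}"
  define p :: real where "p = 2 ^ n"
  \<comment> \<open>Room for the lattice error, for at most p lower faces with weights at most p,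
    and for n facets with at most n subfaces each.\<close>
  define C where "C = \<bar>C0\<bar> + 4 * p * p * B + 2 * real n * real n * B"
  have fin: "finite A" "card A = n" "A \<noteq> {}" using n by (auto simp: A_def lessThan_empty_iff)
  have p: "1 \<le> p" by (simp add: p_def)
  have main: "\<bar>pos_count A a t - (orthant_volume A a t - (\<Sum>j\<in>A. orthant_volume (A - {j}) a t) / 2)\<bar> \<le> C * t powr \<theta> \<and>
    \<bar>nonneg_count A a t - (orthant_volume A a t + (\<Sum>j\<in>A. orthant_volume (A - {j}) a t) / 2)\<bar> \<le> C * t powr \<theta>"
    if t: "max 1 T0 \<le> t" and a: "\<forall>j<n. l \<le> a j \<and> a j \<le> u" for t a
  proof -
    have t1: "1 \<le> t" "T0 \<le> t" using t by auto
    have a': "\<forall>j<n. 0 < a j \<and> a j \<le> U" using a l by (force simp: U_def)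
    have pos: "0 < a j" if "j \<in> A" for j using a' that by (auto simp: A_def)
    have D: "0 \<le> pos_count T a t" "pos_count T a t \<le> orthant_volume T a t" if "T \<subseteq> A" for T
      using that pos t1 fin(1)
      by (auto intro!: pos_count_nonneg pos_count_le_volume intro: finite_subset)
    define r where "r = B * t ^ (n - 2)"
    have V: "orthant_volume T a t \<le> r" if "T \<subseteq> A" "card T + 2 \<le> n" for T
      using B(2)[of T a t "n - 2"] a' t1 that by (auto simp: A_def r_def)
    have r0: "0 \<le> r" using B t1 by (simp add: r_def)
    have r: "r \<le> B * t powr \<theta>"
    proof -
      have "t ^ (n - 2) = t powr (real n - 2)"
        using t1 n powr_realpow[of t "n - 2"] by (simp add: of_nat_diff)
      also have "\<dots> \<le> t powr \<theta>" using t1 admissible_exponent_ge[OF n adm] by (intro powr_mono) auto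
      finally show ?thesis unfolding r_def using B by (intro mult_left_mono) auto
    qed
    let ?L = "{T. T \<subseteq> A \<and> card T + 2 \<le> card A}"
    define X Y Z W where "X = (\<Sum>T\<in>?L. pos_count T a t)" and "Y = (\<Sum>T\<in>?L. 2 ^ card T * pos_count T a t)"
      and "Z = (\<Sum>j\<in>A. pos_count (A - {j}) a t)" and "W = (\<Sum>j\<in>A. orthant_volume (A - {j}) a t)"
    have cL: "real (card ?L) \<le> p"
    proof -
      have "card ?L \<le> card (Pow A)" by (intro card_mono) (use fin in auto)
      thus ?thesis using fin by (simp add: card_Pow p_def flip: of_nat_le_iff)
    qed
    have XY0: "0 \<le> X" "0 \<le> Y" unfolding X_def Y_def using D by (auto intro!: sum_nonneg)
    have DL: "pos_count T a t \<le> r" if "T \<in> ?L" for T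
      using D(2)[of T] V[of T] that fin by auto
    have "X \<le> (\<Sum>T\<in>?L. r)" unfolding X_def by (intro sum_mono DL)
    also have "\<dots> \<le> p * r" using cL r0 by (simp add: mult_right_mono)
    finally have X1: "X \<le> p * r" .
    have "Y \<le> (\<Sum>T\<in>?L. p * r)" unfolding Y_def
    proof (intro sum_mono mult_mono DL)
      fix T assume "T \<in> ?L"
      thus "2 ^ card T \<le> p" unfolding p_def using fin by (intro power_increasing) auto
      show "0 \<le> pos_count T a t" by (simp add: pos_count_def)
    qed (use p in auto)
    also have "\<dots> \<le> p * (p * r)" using cL r0 p by (simp add: mult_right_mono)
    finally have Y1: "Y \<le> p * (p * r)" .
    have Z1: "Z \<le> W" unfolding Z_def W_def by (intro sum_mono D) auto
    have "W - real n * (real n * r) \<le> Z"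
    proof -
      have "orthant_volume (A - {j}) a t - real n * r \<le> pos_count (A - {j}) a t" if j: "j \<in> A" for j
      proof -
        have "(\<Sum>k\<in>A - {j}. orthant_volume (A - {j} - {k}) a t) \<le> (\<Sum>k\<in>A - {j}. r)"
        proof (intro sum_mono V)
          fix k assume "k \<in> A - {j}"
          hence "card (A - {j} - {k}) = n - 2" using j fin by simp
          thus "card (A - {j} - {k}) + 2 \<le> n" using n by simp
        qed auto
        also have "\<dots> \<le> real n * r" using j fin r0 by (simp add: mult_right_mono)
        finally have "(\<Sum>k\<in>A - {j}. orthant_volume (A - {j} - {k}) a t) \<le> real n * r" .
        moreover have "orthant_volume (A - {j}) a t - (\<Sum>k\<in>A - {j}. orthant_volume (A - {j} - {k}) a t) \<le> pos_count (A - {j}) a t"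
          using fin pos t1 by (intro pos_count_ge_volume) auto
        ultimately show ?thesis by simp
      qed
      hence "(\<Sum>j\<in>A. orthant_volume (A - {j}) a t - real n * r) \<le> Z" unfolding Z_def by (rule sum_mono)
      thus ?thesis using fin by (simp add: W_def sum_subtractf)
    qed
    note Z2 = this
    have E: "int_count A a t = p * pos_count A a t + p / 2 * Z + Y"
    proof -
      have c: "2 ^ card (A - {j}) * pos_count (A - {j}) a t = p / 2 * pos_count (A - {j}) a t" if "j \<in> A" for j
      proof -
        have "p = 2 * 2 ^ (n - 1)" using n by (simp add: p_def power_Suc[symmetric] del: power_Suc)
        thus ?thesis using that fin by simp
      qed
      have "int_count A a t = (\<Sum>T\<in>Pow A. 2 ^ card T * pos_count T a t)"
        using fin pos t1 by (intro int_count_eq) auto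
      also have "\<dots> = 2 ^ card A * pos_count A a t + (\<Sum>j\<in>A. 2 ^ card (A - {j}) * pos_count (A - {j}) a t) + Y"
        unfolding Y_def using fin by (intro sum_Pow_by_codimension)
      also have "(\<Sum>j\<in>A. 2 ^ card (A - {j}) * pos_count (A - {j}) a t) = p / 2 * Z"
        unfolding Z_def sum_distrib_left by (intro sum.cong refl c)
      finally show ?thesis using fin by (simp add: p_def)
    qed
    have M: "nonneg_count A a t = pos_count A a t + Z + X"
      unfolding X_def Z_def using fin pos t1 sum_Pow_by_codimension[of A "\<lambda>T. pos_count T a t"]
      by (subst nonneg_count_eq) auto
    have "p * orthant_volume A a t = unit_ball_vol (real n) * t ^ n * (\<Prod>j<n. a j)"
      using fin by (simp add: orthant_volume_def A_def p_def)
    moreover have "C0 * t powr \<theta> \<le> \<bar>C0\<bar> * t powr \<theta>" by (intro mult_right_mono) auto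
    ultimately have E2: "\<bar>int_count A a t - p * orthant_volume A a t\<bar> \<le> \<bar>C0\<bar> * t powr \<theta>"
      using T0[OF t1(2), of a] a by (simp add: A_def)
    \<comment> \<open>The combination that the hypothesis controls. The Dirichlet error is e + (W -
      Z)/2, the Neumann error e + (Z - W)/2 + X.\<close>
    define e where "e = pos_count A a t + Z / 2 - orthant_volume A a t"
    have "p * e = (int_count A a t - p * orthant_volume A a t) - Y" by (simp add: E e_def algebra_simps)
    hence "p * \<bar>e\<bar> = \<bar>(int_count A a t - p * orthant_volume A a t) - Y\<bar>" using p by (metis abs_mult abs_of_nonneg order_trans zero_le_one)
    also have "\<dots> \<le> \<bar>C0\<bar> * t powr \<theta> + p * (p * r)" using E2 Y1 XY0 by linarith
    finally have "p * \<bar>e\<bar> \<le> \<bar>C0\<bar> * t powr \<theta> + p * (p * r)" .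
    moreover have "\<bar>e\<bar> \<le> p * \<bar>e\<bar>" using p mult_right_mono[of 1 p "\<bar>e\<bar>"] by simp
    ultimately have e: "\<bar>e\<bar> \<le> \<bar>C0\<bar> * t powr \<theta> + p * (p * r)" by linarith
    have pr: "p * r \<le> p * (p * r)" using p r0 mult_right_mono[of 1 p "p * r"] by simp
    have fin_bound: "\<bar>C0\<bar> * t powr \<theta> + 2 * (p * (p * r)) + real n * (real n * r) \<le> C * t powr \<theta>"
    proof -
      have "2 * (p * (p * r)) + real n * (real n * r) = (2 * p * p + real n * real n) * r" by (simp add: algebra_simps)
      also have "\<dots> \<le> (2 * p * p + real n * real n) * (B * t powr \<theta>)"
        using r p by (intro mult_left_mono) auto
      also have "\<dots> \<le> (4 * p * p + 2 * real n * real n) * (B * t powr \<theta>)"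
        using B p by (intro mult_right_mono) auto
      finally show ?thesis by (simp add: C_def algebra_simps)
    qed
    have pr0: "0 \<le> p * (p * r)" using p r0 by simp
    have "\<bar>pos_count A a t - (orthant_volume A a t - W / 2)\<bar> \<le> C * t powr \<theta>"
      using e Z1 Z2 fin_bound pr0 unfolding e_def by linarith
    moreover have "\<bar>nonneg_count A a t - (orthant_volume A a t + W / 2)\<bar> \<le> C * t powr \<theta>"
      using e Z1 Z2 fin_bound pr0 M X1 XY0 pr unfolding e_def by linarith
    ultimately show ?thesis by (simp add: W_def)
  qed
  have "C \<ge> 0" using p B by (simp add: C_def)
  thus ?thesis using main unfolding A_def by (intro exI[of _ C] conjI exI[of _ "max 1 T0"]) auto
qed

section \<open>Comparison of the radii\<close>

text \<open>AM-GM through the tangent bound 1 - ln x <= 1/x: the logarithms add up to 0 because the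
  product of the sides is 1.\<close>

lemma sum_inverse_sides_ge:
  assumes "a \<in> unit_measure_cuboids n"
  shows "real n \<le> (\<Sum>j<n. 1 / a j)"
proof -
  have pos: "0 < a j" if "j < n" for j using assms that by (simp add: unit_measure_cuboids_def)
  have "(\<Sum>j<n. ln (a j)) = ln (\<Prod>j<n. a j)" by (intro ln_prod[symmetric]) (auto dest!: pos)
  hence "(\<Sum>j<n. ln (a j)) = 0" using assms by (simp add: unit_measure_cuboids_def)
  hence "real n = (\<Sum>j<n. 1 - ln (a j))" by (simp add: sum_subtractf)
  also have "\<dots> \<le> (\<Sum>j<n. 1 / a j)"
  proof (intro sum_mono)
    fix j assume "j \<in> {..<n}"
    hence "0 < a j" using pos by simp
    thus "1 - ln (a j) \<le> 1 / a j" using ln_le_minus_one[of "1 / a j"] by (simp add: ln_div)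
  qed
  finally show ?thesis .
qed

text \<open>s and u are the radii of the two cuboids to be compared. After AM-GM one polynomial
  estimates both counts, with \<open>b\<close> negative for Dirichlet and positive for Neumann. The
  hypothesis says that it grows on [s, u) by no more than the errors, and its growth rate t^(n-1)
  then limits the gap.\<close>

lemma radius_gap:
  fixes n :: nat and \<omega> b C \<theta> :: real
  assumes n: "n \<ge> 2" and \<omega>: "0 < \<omega>" and C: "0 \<le> C" and \<theta>: "real n - 2 \<le> \<theta>"
  shows "\<exists>T\<ge>1. \<exists>G\<ge>0. \<forall>s u. T \<le> s \<longrightarrow> s \<le> u \<longrightarrow>
    (\<forall>t. s \<le> t \<longrightarrow> t < u \<longrightarrow>
      \<omega> * t ^ n + b * t ^ (n - 1) - C * t powr \<theta> \<le> \<omega> * s ^ n + b * s ^ (n - 1) + C * s powr \<theta>) \<longrightarrow>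
    u\<^sup>2 - s\<^sup>2 \<le> G * u powr (\<theta> - (real n - 2))"
proof -
  \<comment> \<open>Beyond this radius the term with b cancels at most half of the growth of
    \<omega> t^n.\<close>
  define T where "T = max 1 (2 * \<bar>b\<bar> * real n / \<omega>)"
  \<comment> \<open>A factor 2 each for the half of the growth that is kept, for t + s <= 2 t, and
    for the two error terms.\<close>
  define G where "G = 8 * C / \<omega>"
  have "u\<^sup>2 - s\<^sup>2 \<le> G * u powr (\<theta> - (real n - 2))"
    if s: "T \<le> s" "s \<le> u" and gap: "\<forall>t. s \<le> t \<longrightarrow> t < u \<longrightarrow>
      \<omega> * t ^ n + b * t ^ (n - 1) - C * t powr \<theta> \<le> \<omega> * s ^ n + b * s ^ (n - 1) + C * s powr \<theta>" for s u
  proof (cases "s = u")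
    case True
    thus ?thesis using C \<omega> by (simp add: G_def)
  next
    case False
    hence su: "s < u" using s by simp
    have s1: "1 \<le> s" "2 * \<bar>b\<bar> * real n / \<omega> \<le> s" using s by (auto simp: T_def)
    have "t\<^sup>2 - s\<^sup>2 \<le> G * u powr (\<theta> - (real n - 2))" if t: "s \<le> t" "t < u" for t
    proof -
      have t1: "1 \<le> t" using t s1 by simp
      have pn: "t ^ (n - 1) = t * t ^ (n - 2)"
      proof -
        have "n - 1 = Suc (n - 2)" using n by simp
        thus ?thesis by simp
      qed
      have "2 * \<bar>b\<bar> * real n / \<omega> \<le> t" using s1(2) t(1) by simp
      hence bt: "2 * \<bar>b\<bar> * real n \<le> \<omega> * t" using \<omega> by (simp add: field_simps)
      have 1: "\<omega> * (t ^ (n - 1) * (t - s)) \<le> \<omega> * (t ^ n - s ^ n)"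
        using \<omega> s1 t n by (intro mult_left_mono power_diff_ge) auto
      have mono: "s ^ (n - 1) \<le> t ^ (n - 1)" using s1 t by (intro power_mono) auto
      have "b * (s ^ (n - 1) - t ^ (n - 1)) \<le> \<bar>b\<bar> * (t ^ (n - 1) - s ^ (n - 1))"
        using mult_right_mono[of "-b" "\<bar>b\<bar>" "t ^ (n - 1) - s ^ (n - 1)"] mono by (simp add: algebra_simps)
      also have "\<dots> \<le> \<bar>b\<bar> * (real (n - 1) * t ^ (n - 1 - 1) * (t - s))"
        using s1 t by (intro mult_left_mono power_diff_le) auto
      also have "\<dots> \<le> \<bar>b\<bar> * (real n * t ^ (n - 2) * (t - s))"
        using s1 t by (intro mult_left_mono mult_right_mono) (auto simp: numeral_2_eq_2)
      also have "\<dots> = (2 * \<bar>b\<bar> * real n) * (t ^ (n - 2) * (t - s) / 2)" by simp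
      also have "\<dots> \<le> (\<omega> * t) * (t ^ (n - 2) * (t - s) / 2)"
        using bt t t1 by (intro mult_right_mono) auto
      finally have 2: "b * (s ^ (n - 1) - t ^ (n - 1)) \<le> \<omega> * (t ^ (n - 1) * (t - s)) / 2"
        unfolding pn by (simp add: mult_ac)
      have "\<omega> * (t ^ n - s ^ n) - b * (s ^ (n - 1) - t ^ (n - 1)) \<le> C * t powr \<theta> + C * s powr \<theta>"
        using gap t by (simp add: algebra_simps) (smt (verit))
      also have "\<dots> \<le> C * t powr \<theta> + C * t powr \<theta>"
        using C s1 t \<theta> n by (intro add_mono mult_left_mono powr_mono2) auto
      finally have 3: "\<omega> * (t ^ (n - 1) * (t - s)) / 2 \<le> 2 * (C * t powr \<theta>)" using 1 2 by linarith
      have "t ^ (n - 2) * (t\<^sup>2 - s\<^sup>2) = t ^ (n - 2) * ((t + s) * (t - s))" by (simp add: algebra_simps power2_eq_square)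
      also have "\<dots> \<le> t ^ (n - 2) * ((2 * t) * (t - s))"
        using t t1 by (intro mult_left_mono mult_right_mono) auto
      also have "\<dots> = 4 / \<omega> * (\<omega> * (t ^ (n - 1) * (t - s)) / 2)" using \<omega> unfolding pn by simp
      also have "\<dots> \<le> 4 / \<omega> * (2 * (C * t powr \<theta>))" using 3 \<omega> by (intro mult_left_mono) auto
      also have "\<dots> = G * t powr \<theta>" by (simp add: G_def)
      finally have "t ^ (n - 2) * (t\<^sup>2 - s\<^sup>2) \<le> G * t powr \<theta>" .
      moreover have "t ^ (n - 2) = t powr (real n - 2)"
        using t1 n powr_realpow[of t "n - 2"] by (simp add: of_nat_diff)
      ultimately have "t powr (real n - 2) * (t\<^sup>2 - s\<^sup>2) \<le> G * t powr \<theta>" by simp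
      hence "t\<^sup>2 - s\<^sup>2 \<le> G * t powr \<theta> / t powr (real n - 2)"
        using t1 by (subst pos_le_divide_eq) (auto simp: mult.commute)
      hence "t\<^sup>2 - s\<^sup>2 \<le> G * t powr (\<theta> - (real n - 2))"
        unfolding powr_diff[of t \<theta> "real n - 2"] by simp
      also have "\<dots> \<le> G * u powr (\<theta> - (real n - 2))"
        using t t1 \<theta> C \<omega> by (intro mult_left_mono powr_mono2) (auto simp: G_def)
      finally show ?thesis .
    qed
    thus ?thesis by (rule le_at_left_limit[OF su]) (auto intro!: continuous_intros)
  qed
  moreover have "1 \<le> T" "0 \<le> G" using C \<omega> by (auto simp: T_def G_def)
  ultimately show ?thesis by blast
qed

text \<open>The threshold comes out of \<open>radius_gap\<close>, so s and u must be supplied beyond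
  every \<open>T\<close>. The condition \<open>u ^ n \<le> c * real k\<close> converts a power of
  the radius into one of k, monotonically because the exponent is nonnegative.\<close>

lemma radius_gap_bigo:
  fixes n :: nat and \<omega> b C \<theta> c :: real and d :: "nat \<Rightarrow> real"
  assumes n: "n \<ge> 2" and \<omega>: "0 < \<omega>" and C: "0 \<le> C" and \<theta>: "real n - 2 \<le> \<theta>" and c: "0 \<le> c"
    and ev: "\<And>T. \<forall>\<^sub>F k in sequentially. \<exists>s u. T \<le> s \<and> s \<le> u \<and> d k = pi\<^sup>2 * (u\<^sup>2 - s\<^sup>2) \<and> u ^ n \<le> c * real k \<and>
      (\<forall>t. s \<le> t \<longrightarrow> t < u \<longrightarrow>
        \<omega> * t ^ n + b * t ^ (n - 1) - C * t powr \<theta> \<le> \<omega> * s ^ n + b * s ^ (n - 1) + C * s powr \<theta>)"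
  shows "d \<in> O(\<lambda>k. real k powr ((\<theta> - (real n - 2)) / real n))"
proof -
  define \<alpha> where "\<alpha> = (\<theta> - (real n - 2)) / real n"
  have \<alpha>: "0 \<le> \<alpha>" "\<theta> - (real n - 2) = real n * \<alpha>" using \<theta> n by (auto simp: \<alpha>_def)
  obtain T G where T: "1 \<le> T" "0 \<le> G" and gap: "\<And>s u. T \<le> s \<Longrightarrow> s \<le> u \<Longrightarrow>
    (\<forall>t. s \<le> t \<longrightarrow> t < u \<longrightarrow>
      \<omega> * t ^ n + b * t ^ (n - 1) - C * t powr \<theta> \<le> \<omega> * s ^ n + b * s ^ (n - 1) + C * s powr \<theta>) \<Longrightarrow>
    u\<^sup>2 - s\<^sup>2 \<le> G * u powr (\<theta> - (real n - 2))"
    using radius_gap[OF n \<omega> C \<theta>, of b] by blast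
  have "\<forall>\<^sub>F k in sequentially. norm (d k) \<le> (pi\<^sup>2 * G * c powr \<alpha>) * norm (real k powr \<alpha>)"
    using ev[of T]
  proof eventually_elim
    case (elim k)
    then obtain s u where su: "T \<le> s" "s \<le> u" "d k = pi\<^sup>2 * (u\<^sup>2 - s\<^sup>2)" "u ^ n \<le> c * real k"
      and g: "\<forall>t. s \<le> t \<longrightarrow> t < u \<longrightarrow>
        \<omega> * t ^ n + b * t ^ (n - 1) - C * t powr \<theta> \<le> \<omega> * s ^ n + b * s ^ (n - 1) + C * s powr \<theta>" by blast
    have u: "1 \<le> u" using su T by simp
    have "s\<^sup>2 \<le> u\<^sup>2" using su T by (intro power_mono) auto
    hence "norm (d k) = pi\<^sup>2 * (u\<^sup>2 - s\<^sup>2)" by (simp add: su(3))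
    also have "\<dots> \<le> pi\<^sup>2 * (G * u powr (\<theta> - (real n - 2)))"
      using gap[OF su(1,2) g] by (intro mult_left_mono) auto
    finally have 1: "norm (d k) \<le> pi\<^sup>2 * (G * u powr (\<theta> - (real n - 2)))" .
    have "u powr (\<theta> - (real n - 2)) \<le> c powr \<alpha> * real k powr \<alpha>"
    proof -
      have "u powr (\<theta> - (real n - 2)) = (u ^ n) powr \<alpha>"
        using u unfolding \<alpha>(2) by (simp add: powr_powr[symmetric] powr_realpow)
      also have "\<dots> \<le> (c * real k) powr \<alpha>" using u su(4) \<alpha> by (intro powr_mono2) auto
      also have "\<dots> = c powr \<alpha> * real k powr \<alpha>" using c by (simp add: powr_mult)
      finally show ?thesis .
    qed
    hence "pi\<^sup>2 * (G * u powr (\<theta> - (real n - 2))) \<le> pi\<^sup>2 * (G * (c powr \<alpha> * real k powr \<alpha>))"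
      using T by (intro mult_left_mono) auto
    from order_trans[OF 1 this] show ?case by (simp add: mult_ac)
  qed
  thus ?thesis unfolding \<alpha>_def[symmetric] by (rule bigoI)
qed

lemma eventually_real_gt: "\<forall>\<^sub>F k in sequentially. x < real k"
  using filterlim_real_sequentially unfolding filterlim_at_top_dense by blast

text \<open>Here s belongs to the optimal cuboid and u to the cube. The sum of the 1/a_j is replaced
  by its minimum n in the upper bound for the cuboid and equals n for the cube, so both bounds share
  the coefficient \<open>b\<close>.\<close>

lemma dirichlet_bigo:
  fixes n :: nat and \<theta> :: real
  assumes n: "n \<ge> 2" and adm: "admissible_exponent n \<theta>"
  shows "(\<lambda>k. \<bar>dirichlet_eigenvalue n k unit_cube - min_dirichlet_eigenvalue n k\<bar>)
           \<in> O(\<lambda>k. real k powr ((\<theta> - (real n - 2)) / real n))"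
proof -
  let ?v = "orthant_const n" and ?w = "orthant_const (n - 1)"
  define l where "l = sum_defect (n - 1) / real n"
  have l: "0 < l" using sum_defect_pos n by (simp add: l_def)
  define U where "U = 1 / l ^ (n - 1)"
  obtain C t0 where C: "0 \<le> C" "1 \<le> t0" and asym: "\<And>t a. t0 \<le> t \<Longrightarrow> (\<forall>j<n. l \<le> a j \<and> a j \<le> U) \<Longrightarrow>
    \<bar>pos_count {..<n} a t - (orthant_volume {..<n} a t - (\<Sum>j<n. orthant_volume ({..<n} - {j}) a t) / 2)\<bar> \<le> C * t powr \<theta>"
    using count_asymptotics[OF n adm l, of U] by blast
  define b where "b = - (real n * ?w / 2)"
  have sides: "\<forall>j<n. l \<le> a j \<and> a j \<le> U"
    if "a \<in> unit_measure_cuboids n" "dirichlet_eigenvalue n k a \<le> dirichlet_eigenvalue n k unit_cube" "k \<ge> 1" for a k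
  proof -
    have "l \<le> a j" if "j < n" for j
      unfolding l_def using dirichlet_sides_bound[OF n _ _ _ that] \<open>a \<in> _\<close> \<open>dirichlet_eigenvalue n k a \<le> _\<close> \<open>k \<ge> 1\<close> by blast
    thus ?thesis using unit_cuboid_sides_le[OF \<open>a \<in> _\<close> l] by (auto simp: U_def)
  qed
  have surface: "(\<Sum>j<n. orthant_volume ({..<n} - {j}) a t) = ?w * t ^ (n - 1) * (\<Sum>j<n. 1 / a j)"
    if "a \<in> unit_measure_cuboids n" for a t
    unfolding sum_distrib_left using that by (intro sum.cong) (auto simp: orthant_volume_unit_face)
  have upper: "pos_count {..<n} a t \<le> ?v * t ^ n + b * t ^ (n - 1) + C * t powr \<theta>"
    if "t0 \<le> t" "a \<in> unit_measure_cuboids n" "\<forall>j<n. l \<le> a j \<and> a j \<le> U" for a t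
  proof -
    have "?w * t ^ (n - 1) * real n \<le> ?w * t ^ (n - 1) * (\<Sum>j<n. 1 / a j)"
      using that C orthant_const_pos[of "n - 1"] by (intro mult_left_mono sum_inverse_sides_ge) auto
    thus ?thesis using asym[OF that(1,3)] unfolding surface[OF that(2)] orthant_volume_unit[OF that(2)]
      by (simp add: b_def algebra_simps abs_le_iff)
  qed
  have lower: "?v * t ^ n + b * t ^ (n - 1) - C * t powr \<theta> \<le> pos_count {..<n} unit_cube t" if "t0 \<le> t" for t
  proof -
    \<comment> \<open>The cube is as good as itself, so the bounds for competitors put its sides
      into [l, U] too.\<close>
    have "\<forall>j<n. l \<le> unit_cube j \<and> unit_cube j \<le> U" by (rule sides[OF unit_cube_in, of 1]) auto
    from asym[OF that this] show ?thesis
      unfolding surface[OF unit_cube_in] orthant_volume_unit[OF unit_cube_in]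
      by (simp add: b_def unit_cube_def algebra_simps abs_le_iff)
  qed
  \<comment> \<open>Converts radii into indices: beyond the threshold the surface loss is at most
    half of the volume.\<close>
  have half: "?v / 2 * t ^ n \<le> pos_count {..<n} unit_cube t" if t: "0 \<le> t" "2 * real n * ?w / ?v \<le> t" for t
  proof -
    have pn: "t ^ n = t * t ^ (n - 1)" using n by (cases n) auto
    have "2 * real n * ?w \<le> ?v * t" using t orthant_const_pos[of n] by (simp add: field_simps)
    hence "(2 * real n * ?w) * (t ^ (n - 1) / 2) \<le> (?v * t) * (t ^ (n - 1) / 2)"
      using t by (intro mult_right_mono) auto
    hence "?v / 2 * t ^ n \<le> ?v * t ^ n - real n * ?w * t ^ (n - 1)" by (simp add: pn algebra_simps)
    also have "\<dots> = orthant_volume {..<n} unit_cube t - (\<Sum>i<n. orthant_volume ({..<n} - {i}) unit_cube t)"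
      unfolding surface[OF unit_cube_in] orthant_volume_unit[OF unit_cube_in] by (simp add: unit_cube_def)
    also have "\<dots> \<le> pos_count {..<n} unit_cube t"
      using t by (intro pos_count_ge_volume) (auto simp: unit_cube_def)
    finally show ?thesis .
  qed
  show ?thesis
  proof (rule radius_gap_bigo[OF n orthant_const_pos C(1) admissible_exponent_ge[OF n adm]])
    show "0 \<le> 2 / ?v" using orthant_const_pos[of n] by simp
    fix T :: real
    define T' where "T' = max (max T t0) (2 * real n * ?w / ?v)"
    have T': "T \<le> T'" "t0 \<le> T'" "2 * real n * ?w / ?v \<le> T'" "1 \<le> T'" using C by (auto simp: T'_def)
    show "\<forall>\<^sub>F k in sequentially. \<exists>s u. T \<le> s \<and> s \<le> u \<and>
        \<bar>dirichlet_eigenvalue n k unit_cube - min_dirichlet_eigenvalue n k\<bar> = pi\<^sup>2 * (u\<^sup>2 - s\<^sup>2) \<and>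
        u ^ n \<le> 2 / ?v * real k \<and> (\<forall>t. s \<le> t \<longrightarrow> t < u \<longrightarrow>
          ?v * t ^ n + b * t ^ (n - 1) - C * t powr \<theta> \<le> ?v * s ^ n + b * s ^ (n - 1) + C * s powr \<theta>)"
      using eventually_ge_at_top[of "1::nat"] eventually_real_gt[of "?v * T' ^ n"]
    proof eventually_elim
      case (elim k)
      obtain a where a: "a \<in> unit_measure_cuboids n" "min_dirichlet_eigenvalue n k = dirichlet_eigenvalue n k a"
        "\<forall>b\<in>unit_measure_cuboids n. dirichlet_eigenvalue n k a \<le> dirichlet_eigenvalue n k b"
        using min_dirichlet_attained[OF n elim(1)] by blast
      have pos: "0 < a j" if "j < n" for j using a(1) that by (simp add: unit_measure_cuboids_def)
      have le: "dirichlet_eigenvalue n k a \<le> dirichlet_eigenvalue n k unit_cube" using a(3) unit_cube_in by blast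
      obtain s where s: "0 \<le> s" "dirichlet_eigenvalue n k a = pi\<^sup>2 * s\<^sup>2"
        "\<And>t. 0 \<le> t \<Longrightarrow> s \<le> t \<longleftrightarrow> real k \<le> pos_count {..<n} a t"
        using dirichlet_radius[of n k a] n elim(1) pos by auto
      obtain u where u: "0 \<le> u" "dirichlet_eigenvalue n k unit_cube = pi\<^sup>2 * u\<^sup>2"
        "\<And>t. 0 \<le> t \<Longrightarrow> u \<le> t \<longleftrightarrow> real k \<le> pos_count {..<n} unit_cube t"
        using dirichlet_radius[of n k unit_cube] n elim(1) by (auto simp: unit_cube_def)
      have su: "s \<le> u" using le s(1,2) u(1,2) by (simp add: power2_le_iff_abs_le)
      \<comment> \<open>The volume bound is the same for all unit-measure cuboids, so large k forces
        a large radius although the optimal cuboid varies with k.\<close>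
      have sT: "T' < s"
      proof (rule ccontr)
        assume "\<not> T' < s"
        hence "real k \<le> pos_count {..<n} a T'" using s(3)[of T'] T' by simp
        also have "\<dots> \<le> ?v * T' ^ n"
          using pos_count_le_volume[of "{..<n}" a T'] pos T' orthant_volume_unit[OF a(1)] by auto
        finally show False using elim(2) by simp
      qed
      have below: "pos_count {..<n} unit_cube t \<le> real k" if "0 \<le> t" "t < u" for t
        using u(3)[of t] that by simp
      have "?v / 2 * t ^ n \<le> real k" if "T' \<le> t" "t < u" for t
        using half[of t] below[of t] that T' by simp
      hence "?v / 2 * u ^ n \<le> real k"
        by (rule le_at_left_limit[of T', rotated]) (use sT su in \<open>auto intro!: continuous_intros\<close>)
      hence un: "u ^ n \<le> 2 / ?v * real k" using orthant_const_pos[of n] by (simp add: field_simps)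
      have "real k \<le> pos_count {..<n} a s" using s(3)[OF s(1)] by simp
      also have "\<dots> \<le> ?v * s ^ n + b * s ^ (n - 1) + C * s powr \<theta>"
        using sT T' by (intro upper a sides[OF a(1) le elim(1)]) auto
      finally have ks: "real k \<le> ?v * s ^ n + b * s ^ (n - 1) + C * s powr \<theta>" .
      have "?v * t ^ n + b * t ^ (n - 1) - C * t powr \<theta> \<le> ?v * s ^ n + b * s ^ (n - 1) + C * s powr \<theta>"
        if "s \<le> t" "t < u" for t
        using lower[of t] below[of t] ks that sT T' by simp
      moreover have "\<bar>dirichlet_eigenvalue n k unit_cube - min_dirichlet_eigenvalue n k\<bar> = pi\<^sup>2 * (u\<^sup>2 - s\<^sup>2)"
        using le unfolding a(2) s(2) u(2) by (simp add: algebra_simps)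
      moreover have "T \<le> s" using sT T' by simp
      ultimately show ?case using su un by blast
    qed
  qed
qed

text \<open>The roles are exchanged: s belongs to the cube and u to the optimal cuboid, and AM-GM
  enters the lower bound.\<close>

lemma neumann_bigo:
  fixes n :: nat and \<theta> :: real
  assumes n: "n \<ge> 2" and adm: "admissible_exponent n \<theta>"
  shows "(\<lambda>k. \<bar>neumann_eigenvalue n k unit_cube - max_neumann_eigenvalue n k\<bar>)
           \<in> O(\<lambda>k. real k powr ((\<theta> - (real n - 2)) / real n))"
proof -
  let ?v = "orthant_const n" and ?w = "orthant_const (n - 1)"
  obtain l where l: "0 < l" and l_le: "\<And>k a j. k \<ge> 1 \<Longrightarrow> a \<in> unit_measure_cuboids n \<Longrightarrow>
    neumann_eigenvalue n k unit_cube \<le> neumann_eigenvalue n k a \<Longrightarrow> j < n \<Longrightarrow> l \<le> a j"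
    using neumann_sides_bound[OF n] by blast
  define U where "U = 1 / l ^ (n - 1)"
  obtain C t0 where C: "0 \<le> C" "1 \<le> t0" and asym: "\<And>t a. t0 \<le> t \<Longrightarrow> (\<forall>j<n. l \<le> a j \<and> a j \<le> U) \<Longrightarrow>
    \<bar>nonneg_count {..<n} a t - (orthant_volume {..<n} a t + (\<Sum>j<n. orthant_volume ({..<n} - {j}) a t) / 2)\<bar> \<le> C * t powr \<theta>"
    using count_asymptotics[OF n adm l, of U] by blast
  define b where "b = real n * ?w / 2"
  have sides: "\<forall>j<n. l \<le> a j \<and> a j \<le> U"
    if "a \<in> unit_measure_cuboids n" "neumann_eigenvalue n k unit_cube \<le> neumann_eigenvalue n k a" "k \<ge> 1" for a k
    using unit_cuboid_sides_le[OF that(1) l] l_le[OF that(3,1,2)] by (auto simp: U_def)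
  have surface: "(\<Sum>j<n. orthant_volume ({..<n} - {j}) a t) = ?w * t ^ (n - 1) * (\<Sum>j<n. 1 / a j)"
    if "a \<in> unit_measure_cuboids n" for a t
    unfolding sum_distrib_left using that by (intro sum.cong) (auto simp: orthant_volume_unit_face)
  have lower: "?v * t ^ n + b * t ^ (n - 1) - C * t powr \<theta> \<le> nonneg_count {..<n} a t"
    if "t0 \<le> t" "a \<in> unit_measure_cuboids n" "\<forall>j<n. l \<le> a j \<and> a j \<le> U" for a t
  proof -
    have "?w * t ^ (n - 1) * real n \<le> ?w * t ^ (n - 1) * (\<Sum>j<n. 1 / a j)"
      using that C orthant_const_pos[of "n - 1"] by (intro mult_left_mono sum_inverse_sides_ge) auto
    thus ?thesis using asym[OF that(1,3)] unfolding surface[OF that(2)] orthant_volume_unit[OF that(2)]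
      by (simp add: b_def algebra_simps abs_le_iff)
  qed
  have upper: "nonneg_count {..<n} unit_cube t \<le> ?v * t ^ n + b * t ^ (n - 1) + C * t powr \<theta>" if "t0 \<le> t" for t
  proof -
    have "\<forall>j<n. l \<le> unit_cube j \<and> unit_cube j \<le> U" by (rule sides[OF unit_cube_in, of 1]) auto
    from asym[OF that this] show ?thesis
      unfolding surface[OF unit_cube_in] orthant_volume_unit[OF unit_cube_in]
      by (simp add: b_def unit_cube_def algebra_simps abs_le_iff)
  qed
  show ?thesis
  proof (rule radius_gap_bigo[OF n orthant_const_pos C(1) admissible_exponent_ge[OF n adm]])
    show "0 \<le> 1 / ?v" using orthant_const_pos[of n] by simp
    fix T :: real
    define T' where "T' = max T t0"
    have T': "T \<le> T'" "t0 \<le> T'" "1 \<le> T'" using C by (auto simp: T'_def)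
    show "\<forall>\<^sub>F k in sequentially. \<exists>s u. T \<le> s \<and> s \<le> u \<and>
        \<bar>neumann_eigenvalue n k unit_cube - max_neumann_eigenvalue n k\<bar> = pi\<^sup>2 * (u\<^sup>2 - s\<^sup>2) \<and>
        u ^ n \<le> 1 / ?v * real k \<and> (\<forall>t. s \<le> t \<longrightarrow> t < u \<longrightarrow>
          ?v * t ^ n + b * t ^ (n - 1) - C * t powr \<theta> \<le> ?v * s ^ n + b * s ^ (n - 1) + C * s powr \<theta>)"
      using eventually_ge_at_top[of "1::nat"] eventually_real_gt[of "nonneg_count {..<n} unit_cube T'"]
    proof eventually_elim
      case (elim k)
      obtain a where a: "a \<in> unit_measure_cuboids n" "max_neumann_eigenvalue n k = neumann_eigenvalue n k a"
        "\<forall>b\<in>unit_measure_cuboids n. neumann_eigenvalue n k b \<le> neumann_eigenvalue n k a"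
        using max_neumann_attained[OF n elim(1)] by blast
      have pos: "0 < a j" if "j < n" for j using a(1) that by (simp add: unit_measure_cuboids_def)
      have le: "neumann_eigenvalue n k unit_cube \<le> neumann_eigenvalue n k a" using a(3) unit_cube_in by blast
      obtain u where u: "0 \<le> u" "neumann_eigenvalue n k a = pi\<^sup>2 * u\<^sup>2"
        "\<And>t. 0 \<le> t \<Longrightarrow> u \<le> t \<longleftrightarrow> real k < nonneg_count {..<n} a t"
        using neumann_radius[of n a k] n pos by auto
      obtain s where s: "0 \<le> s" "neumann_eigenvalue n k unit_cube = pi\<^sup>2 * s\<^sup>2"
        "\<And>t. 0 \<le> t \<Longrightarrow> s \<le> t \<longleftrightarrow> real k < nonneg_count {..<n} unit_cube t"
        using neumann_radius[of n unit_cube k] n by (auto simp: unit_cube_def)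
      have su: "s \<le> u" using le s(1,2) u(1,2) by (simp add: power2_le_iff_abs_le)
      have sT: "T' < s" using s(3)[of T'] T' elim(2) by simp
      have below: "nonneg_count {..<n} a t \<le> real k" if "0 \<le> t" "t < u" for t
        using u(3)[of t] that by simp
      \<comment> \<open>The Neumann count dominates the volume at every radius, which gives the
        factor \<open>1 / ?v\<close> without a threshold.\<close>
      have "?v * t ^ n \<le> real k" if "0 \<le> t" "t < u" for t
      proof -
        have "?v * t ^ n \<le> nonneg_count {..<n} a t"
          using nonneg_count_ge_volume[of "{..<n}" a t] pos that orthant_volume_unit[OF a(1)] by auto
        thus ?thesis using below[OF that] by simp
      qed
      hence "?v * u ^ n \<le> real k"
        by (rule le_at_left_limit[of 0, rotated]) (use sT su T' in \<open>auto intro!: continuous_intros\<close>)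
      hence un: "u ^ n \<le> 1 / ?v * real k" using orthant_const_pos[of n] by (simp add: field_simps)
      have "real k \<le> nonneg_count {..<n} unit_cube s" using s(3)[OF s(1)] by simp
      also have "\<dots> \<le> ?v * s ^ n + b * s ^ (n - 1) + C * s powr \<theta>"
        using sT T' by (intro upper) auto
      finally have ks: "real k \<le> ?v * s ^ n + b * s ^ (n - 1) + C * s powr \<theta>" .
      have "?v * t ^ n + b * t ^ (n - 1) - C * t powr \<theta> \<le> ?v * s ^ n + b * s ^ (n - 1) + C * s powr \<theta>"
        if "s \<le> t" "t < u" for t
        using lower[OF _ a(1) sides[OF a(1) le elim(1)], of t] below[of t] ks that sT T' by simp
      moreover have "\<bar>neumann_eigenvalue n k unit_cube - max_neumann_eigenvalue n k\<bar> = pi\<^sup>2 * (u\<^sup>2 - s\<^sup>2)"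
        using le unfolding a(2) s(2) u(2) by (simp add: algebra_simps)
      moreover have "T \<le> s" using sT T' by simp
      ultimately show ?case using su un by blast
    qed
  qed
qed

theorem theorem1p3:
  fixes n :: nat and \<theta> :: real
  assumes "n \<ge> 2"
    and "admissible_exponent n \<theta>"
  shows "(\<lambda>k. \<bar>dirichlet_eigenvalue n k unit_cube - min_dirichlet_eigenvalue n k\<bar>)
           \<in> O(\<lambda>k. real k powr ((\<theta> - (real n - 2)) / real n))
       \<and> (\<lambda>k. \<bar>neumann_eigenvalue n k unit_cube - max_neumann_eigenvalue n k\<bar>)
           \<in> O(\<lambda>k. real k powr ((\<theta> - (real n - 2)) / real n))"
  using dirichlet_bigo[OF assms] neumann_bigo[OF assms] ..

end
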